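(* Consider training a GCN on $P$ local machines by model averaging with global server correction (the algorithm "Learn Locally, Correct Globally" described in the context), with $R$ communication rounds, local learning rate $\eta$, server learning rate $\gamma$, local step size parameters $K$ and $\rho$, $S$ server correction steps per round, and $T=\sum_{r=1}^RK\rho^r+SR$ total steps of gradient updates. Suppose the objectives $\mathcal{L}$ and $\mathcal{L}_p^{\text{local}}$ ($p=1,\dots,P$) are $L$-smooth, $\mathcal{L}$ is bounded below, and the following two assumptions hold for all $\boldsymbol\theta$ and all $p$. (Assumption 1) $\mathbb{E}\big[\|\tilde\nabla\mathcal{L}_p^{\text{local}}(\boldsymbol\theta;\xi)-\mathbb{E}[\tilde\nabla\mathcal{L}_p^{\text{local}}(\boldsymbol\theta;\xi)]\|^2\big]\le\sigma_{\text{var}}^2$ and $\|\mathbb{E}[\tilde\nabla\mathcal{L}_p^{\text{local}}(\boldsymbol\theta;\xi)]-\nabla\mathcal{L}_p^{\text{local}}(\boldsymbol\theta)\|^2\le\sigma_{\text{bias}}^2$. (Assumption 2) $\mathbb{E}\big[\|\tilde\nabla\mathcal{L}_p^{\text{full}}(\boldsymbol\theta;\xi)-\nabla\mathcal{L}_p^{\text{full}}(\boldsymbol\theta)\|^2\big]\le\sigma_{\text{global}}^2$. If $\gamma=\eta=\frac{\sqrt P}{\sqrt T}$, the parameters $K,\rho$ satisfy $\sum_{r=1}^RK^2\rho^{2r}\le\frac{R\,T^{1/2}}{32L^2P^{3/2}}$, and the number of server correction steps is $$S=\max_{r\in\{1,\dots,R\}}\Big(\frac{\kappa^2+2\sigma_{\text{bias}}^2}{1-L\sqrt{P/T}}-G_{\text{local}}^r\Big)\frac{K\rho^r}{G_{\text{global}}^r},$$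 then for any $T\ge L^2P$, $$\frac1T\sum_{t=1}^T\mathbb{E}\big[\|\nabla\mathcal{L}(\bar{\boldsymbol\theta}^t)\|^2\big]=\mathcal{O}\Big(\frac1{\sqrt{PT}}\Big).$$
   Context: Graph and objectives. $\mathcal{G}=(\mathcal{V},\mathcal{E})$ is an undirected graph with $N$ nodes; node $v_i$ has feature vector $\mathbf{x}_i\in\mathbb{R}^d$ and label $\mathbf{y}_i$. For a neighborhood map $\mathcal{N}$ and weights $\boldsymbol\theta=\{\mathbf{W}^{(\ell)}\}_{\ell=1}^{D}$ ($D$ is the number of layers), the GCN output $\mathbf{h}_i^{(D)}$ is given by $\mathbf{h}_i^{(0)}=\mathbf{x}_i$ and $\mathbf{h}_i^{(\ell)}=\sigma\big(\frac1{|\mathcal{N}(v_i)|}\sum_{j\in\mathcal{N}(v_i)}\mathbf{h}_j^{(\ell-1)}\mathbf{W}^{(\ell)}\big)$, with $\sigma$ an activation function; $\phi$ is a loss function. The graph is partitioned into $P$ subgraphs $\mathcal{G}_p=(\mathcal{V}_p,\mathcal{E}_p)$, one per machine, where $\mathcal{N}(v_i)$ denotes neighbors in $\mathcal{G}$ and $\mathcal{N}_p(v_i)$ neighbors in $\mathcal{G}_p$. - Global objective: $\mathcal{L}(\boldsymbol\theta)=\frac1N\sum_{i\in\mathcal{V}}\phi(\mathbf{h}_i^{(D)},\mathbf{y}_i)$ using $\mathcal{N}$. - Local objective: $\mathcal{L}_p^{\text{local}}(\boldsymbol\theta)=\frac1{|\mathcal{V}_p|}\sum_{i\in\mathcal{V}_p}\phi(\mathbf{h}_i^{(D)},\mathbf{y}_i)$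 using $\mathcal{N}_p$. - $\mathcal{L}_p^{\text{full}}(\boldsymbol\theta)=\frac1{|\mathcal{V}_p|}\sum_{i\in\mathcal{V}_p}\phi(\mathbf{h}_i^{(D)},\mathbf{y}_i)$ using $\mathcal{N}$ (and all node features). - $\tilde\nabla\mathcal{L}_p^{\text{local}}(\boldsymbol\theta;\xi)$ is the stochastic gradient computed on a random mini-batch $\xi$ of nodes of $\mathcal{V}_p$ with randomly sampled neighbors; it may be a biased estimator of $\nabla\mathcal{L}_p^{\text{local}}(\boldsymbol\theta)$. - $\tilde\nabla\mathcal{L}_p^{\text{full}}(\boldsymbol\theta;\xi)$ is the stochastic gradient on a random mini-batch of $\mathcal{V}_p$ using all neighbors in $\mathcal{G}$. The server's stochastic gradient is $\tilde\nabla\mathcal{L}(\boldsymbol\theta;\xi)=\frac1P\sum_{p=1}^P\tilde\nabla\mathcal{L}_p^{\text{full}}(\boldsymbol\theta;\xi_p)$ with independent $\xi_1,\dots,\xi_P$, and it is unbiased: $\mathbb{E}[\tilde\nabla\mathcal{L}_p^{\text{full}}(\boldsymbol\theta;\xi_p)]=\nabla\mathcal{L}_p^{\text{full}}(\boldsymbol\theta)$ and $\frac1P\sum_p\nabla\mathcal{L}_p^{\text{full}}(\boldsymbol\theta)=\nabla\mathcal{L}(\boldsymbol\theta)$. Local-global gradient discrepancy: $\kappa^2=\kappa_{\mathbf{A}}^2+\kappa_{\mathbf{X}}^2$, where $\kappa_{\mathbf{A}}^2=\max_{p}\|\nabla\mathcal{L}_p^{\text{local}}(\boldsymbol\theta)-\nabla\mathcal{L}_p^{\text{full}}(\boldsymbol\theta)\|^2$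 and $\kappa_{\mathbf{X}}^2=\max_p\|\nabla\mathcal{L}_p^{\text{full}}(\boldsymbol\theta)-\nabla\mathcal{L}(\boldsymbol\theta)\|^2$, both understood as (finite) uniform bounds over $\boldsymbol\theta$. Smoothness: a differentiable $f$ is $L$-smooth ($L>0$) if $\|\nabla f(\boldsymbol\theta)-\nabla f(\boldsymbol\theta')\|\le L\|\boldsymbol\theta-\boldsymbol\theta'\|$ for all $\boldsymbol\theta,\boldsymbol\theta'$. Algorithm (Learn Locally, Correct Globally), with $\rho>1$. Gradient steps are indexed by $t=1,\dots,T$. In round $r=1,\dots,R$: (i) every machine $p$ sets its parameters to the current global parameters and then performs $K\rho^r$ local steps $\boldsymbol\theta_p^{t+1}=\boldsymbol\theta_p^t-\eta\tilde\nabla\mathcal{L}_p^{\text{local}}(\boldsymbol\theta_p^t;\xi_p^t)$, with mini-batches independent across machines and of the past; these steps have indices $t\in\mathcal{T}_{\text{local}}(r)=\{k+\sum_{j=1}^{r-1}K\rho^j+S(r-1):k=1,\dots,K\rho^r\}$; (ii) the server averages the local parameters; (iii) the server performs $S$ correction steps $\bar{\boldsymbol\theta}^{t+1}=\bar{\boldsymbol\theta}^t-\gamma\tilde\nabla\mathcal{L}(\bar{\boldsymbol\theta}^t;\xi^t)$ with fresh mini-batches; these have indices $t\in\mathcal{T}_{\text{global}}(r)=\{s+\sum_{j=1}^{r}K\rho^j+S(r-1):s=1,\dots,S\}$. During local steps, $\bar{\boldsymbol\theta}^t=\frac1P\sum_{p=1}^P\boldsymbol\theta_p^t$; during server steps,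 $\boldsymbol\theta_p^t=\bar{\boldsymbol\theta}^t$ for all $p$. Minimum gradients in round $r$: $G_{\text{global}}^r=\min_{t\in\mathcal{T}_{\text{global}}(r)}\mathbb{E}[\|\nabla\mathcal{L}(\bar{\boldsymbol\theta}^t)\|^2]$ and $G_{\text{local}}^r=\min_{t\in\mathcal{T}_{\text{local}}(r)}\mathbb{E}\big[\big\|\frac1P\sum_{p=1}^P\nabla\mathcal{L}_p^{\text{local}}(\boldsymbol\theta_p^t)\big\|^2\big]$. Meaning of $\mathcal{O}$: the constant may depend on $L$, the initial gap between $\mathcal{L}$ at the initial parameters and $\inf\mathcal{L}$, $\sigma_{\text{var}}^2$, $\sigma_{\text{bias}}^2$, $\sigma_{\text{global}}^2$, $\kappa^2$, but not on $P,T,R,K,\rho,S$. *)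

theory Defs
  imports "HOL-Probability.Probability" "HOL-Library.Poly_Mapping"
begin

section \<open>Finitely supported families as an inner product space\<close>

text \<open>
  The weight matrices of all layers form one vector, a finitely supported family of reals. Keeping
  it in a single type for all depths and layer widths (instead of one type per dimension) allows
  these to be quantified inside a formula, after the constant hidden in an asymptotic bound.
\<close>

instantiation poly_mapping :: (type, real_vector) real_vector
begin

lift_definition scaleR_poly_mapping :: "real \<Rightarrow> ('a \<Rightarrow>\<^sub>0 'b) \<Rightarrow> ('a \<Rightarrow>\<^sub>0 'b)"
  is "\<lambda>c f k. c *\<^sub>R f k"
  by (erule rev_finite_subset) auto

instance
  by standard
    (rule poly_mapping_eqI;
      simp add: scaleR_poly_mapping.rep_eq lookup_add scaleR_add_right scaleR_add_left)+

end

lemma lookup_scaleR [simp]: "Poly_Mapping.lookup (c *\<^sub>R x) k = c *\<^sub>R Poly_Mapping.lookup x k"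
  by (simp add: scaleR_poly_mapping.rep_eq)

instantiation poly_mapping :: (type, real_inner) real_inner
begin

definition inner_poly_mapping :: "('a \<Rightarrow>\<^sub>0 'b) \<Rightarrow> ('a \<Rightarrow>\<^sub>0 'b) \<Rightarrow> real"
  where "inner_poly_mapping x y =
    (\<Sum>k\<in>Poly_Mapping.keys x. Poly_Mapping.lookup x k \<bullet> Poly_Mapping.lookup y k)"

definition norm_poly_mapping :: "('a \<Rightarrow>\<^sub>0 'b) \<Rightarrow> real"
  where "norm_poly_mapping x = sqrt (x \<bullet> x)"

definition sgn_poly_mapping :: "('a \<Rightarrow>\<^sub>0 'b) \<Rightarrow> ('a \<Rightarrow>\<^sub>0 'b)"
  where "sgn_poly_mapping x = x /\<^sub>R norm x"

definition dist_poly_mapping :: "('a \<Rightarrow>\<^sub>0 'b) \<Rightarrow> ('a \<Rightarrow>\<^sub>0 'b) \<Rightarrow> real"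
  where "dist_poly_mapping x y = norm (x - y)"

definition uniformity_poly_mapping :: "(('a \<Rightarrow>\<^sub>0 'b) \<times> ('a \<Rightarrow>\<^sub>0 'b)) filter"
  where "uniformity_poly_mapping = (INF e\<in>{0<..}. principal {(x, y). dist x y < e})"

definition open_poly_mapping :: "('a \<Rightarrow>\<^sub>0 'b) set \<Rightarrow> bool"
  where "open_poly_mapping U \<longleftrightarrow> (\<forall>x\<in>U. eventually (\<lambda>(x', y). x' = x \<longrightarrow> y \<in> U) uniformity)"

lemma inner_poly_mapping_superset:
  fixes x y :: "'a \<Rightarrow>\<^sub>0 'b"
  assumes "finite I" "Poly_Mapping.keys x \<subseteq> I"
  shows "x \<bullet> y = (\<Sum>k\<in>I. Poly_Mapping.lookup x k \<bullet> Poly_Mapping.lookup y k)"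
  unfolding inner_poly_mapping_def
  using assms by (intro sum.mono_neutral_left) (auto simp: in_keys_iff)

instance
proof
  fix x y z :: "'a \<Rightarrow>\<^sub>0 'b" and c :: real
  let ?I = "Poly_Mapping.keys x \<union> Poly_Mapping.keys y"
  show "dist x y = norm (x - y)" by (rule dist_poly_mapping_def)
  show "sgn x = x /\<^sub>R norm x" by (rule sgn_poly_mapping_def)
  show "(uniformity :: (('a \<Rightarrow>\<^sub>0 'b) \<times> ('a \<Rightarrow>\<^sub>0 'b)) filter)
          = (INF e\<in>{0<..}. principal {(x, y). dist x y < e})"
    by (rule uniformity_poly_mapping_def)
  show "open U \<longleftrightarrow> (\<forall>x\<in>U. eventually (\<lambda>(x', y). x' = x \<longrightarrow> y \<in> U) uniformity)"
    for U :: "('a \<Rightarrow>\<^sub>0 'b) set"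
    by (rule open_poly_mapping_def)
  show "x \<bullet> y = y \<bullet> x"
    using inner_poly_mapping_superset[of ?I x y] inner_poly_mapping_superset[of ?I y x]
    by (simp add: inner_commute)
  show "(x + y) \<bullet> z = x \<bullet> z + y \<bullet> z"
    using inner_poly_mapping_superset[of ?I "x + y" z] inner_poly_mapping_superset[of ?I x z]
      inner_poly_mapping_superset[of ?I y z] Poly_Mapping.keys_add[of x y]
    by (simp add: lookup_add inner_add_left sum.distrib)
  have "Poly_Mapping.keys (c *\<^sub>R x) \<subseteq> Poly_Mapping.keys x"
    by (auto simp: in_keys_iff)
  then show "(c *\<^sub>R x) \<bullet> y = c * (x \<bullet> y)"
    using inner_poly_mapping_superset[of "Poly_Mapping.keys x" "c *\<^sub>R x" y]
    by (simp add: inner_poly_mapping_def sum_distrib_left)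
  show "0 \<le> x \<bullet> x" by (simp add: inner_poly_mapping_def sum_nonneg)
  show "(x \<bullet> x = 0) = (x = 0)"
  proof
    assume "x \<bullet> x = 0"
    then have "\<forall>k\<in>Poly_Mapping.keys x. Poly_Mapping.lookup x k = 0"
      by (simp add: inner_poly_mapping_def sum_nonneg_eq_0_iff)
    then show "x = 0" by (metis in_keys_iff lookup_zero poly_mapping_eqI)
  qed (simp add: inner_poly_mapping_def)
  show "norm x = sqrt (x \<bullet> x)" by (rule norm_poly_mapping_def)
qed

end


section \<open>Gradients, smoothness, means\<close>

definition grad :: "('a::real_inner \<Rightarrow> real) \<Rightarrow> 'a \<Rightarrow> 'a"
  where "grad f \<theta> = (THE g. GDERIV f \<theta> :> g)"

definition smooth_with :: "real \<Rightarrow> ('a::real_inner \<Rightarrow> real) \<Rightarrow> bool"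
  where "smooth_with L f \<longleftrightarrow>
    (\<forall>\<theta>. \<exists>g. GDERIV f \<theta> :> g) \<and>
    (\<forall>\<theta> \<theta>'. norm (grad f \<theta> - grad f \<theta>') \<le> L * norm (\<theta> - \<theta>'))"

lemma grad_eqI:
  assumes "GDERIV f \<theta> :> g"
  shows "grad f \<theta> = g"
  unfolding grad_def
proof (rule the_equality, rule assms)
  fix g' assume "GDERIV f \<theta> :> g'"
  with assms have "(\<lambda>h. h \<bullet> g') = (\<lambda>h. h \<bullet> g)"
    unfolding gderiv_def by (rule has_derivative_unique[rotated])
  then have "(g' - g) \<bullet> g' = (g' - g) \<bullet> g" by meson
  then have "(g' - g) \<bullet> (g' - g) = 0" by (simp add: inner_diff_right)
  then show "g' = g" by simp
qed

text \<open>
  The mean of a vector-valued function under a finitely supported distribution. The Bochner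
  integral is not applicable, because the weight space is not a Banach space; where both make
  sense they agree.
\<close>

definition vmean :: "'b pmf \<Rightarrow> ('b \<Rightarrow> 'a::real_vector) \<Rightarrow> 'a"
  where "vmean q f = (\<Sum>\<xi>\<in>set_pmf q. pmf q \<xi> *\<^sub>R f \<xi>)"

lemma vmean_eq_expectation:
  fixes f :: "'b \<Rightarrow> 'a::{banach, second_countable_topology}"
  assumes "finite (set_pmf q)"
  shows "vmean q f = measure_pmf.expectation q f"
  unfolding vmean_def using assms by (intro integral_measure_pmf[symmetric]) auto


section \<open>Graph convolutional networks on a partitioned graph\<close>

text \<open>The entry \<open>(\<ell>, a, b)\<close> is the entry in row \<open>a\<close> and column \<open>b\<close> of the weight matrix of layer \<open>\<ell>\<close>.\<close>

type_synonym weights = "(nat \<times> nat \<times> nat) \<Rightarrow>\<^sub>0 real"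

text \<open>A set of nodes, and for every layer and node the neighbors that are aggregated.\<close>

type_synonym mini_batch = "nat set \<times> (nat \<Rightarrow> nat \<Rightarrow> nat set)"

text \<open>
  Vectors are functions on the natural numbers, of which the first \<open>width \<ell>\<close> entries matter for
  node representations of layer \<open>\<ell>\<close>; \<open>width 0\<close> is the feature dimension. The machines are
  \<open>1, \<dots>, machines\<close>.
\<close>

record gcn_problem =
  nodes :: "nat set"
  edges :: "(nat \<times> nat) set"
  features :: "nat \<Rightarrow> nat \<Rightarrow> real"
  labels :: "nat \<Rightarrow> nat \<Rightarrow> real"
  depth :: nat
  width :: "nat \<Rightarrow> nat"
  activation :: "real \<Rightarrow> real"
  node_loss :: "(nat \<Rightarrow> real) \<Rightarrow> (nat \<Rightarrow> real) \<Rightarrow> real"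
  machines :: nat
  part_nodes :: "nat \<Rightarrow> nat set"
  part_edges :: "nat \<Rightarrow> (nat \<times> nat) set"
  local_batch :: "nat \<Rightarrow> mini_batch pmf"
  full_batch :: "nat \<Rightarrow> nat set pmf"

definition nbrs :: "gcn_problem \<Rightarrow> nat \<Rightarrow> nat set"
  where "nbrs G i = edges G `` {i}"

definition part_nbrs :: "gcn_problem \<Rightarrow> nat \<Rightarrow> nat \<Rightarrow> nat set"
  where "part_nbrs G p i = part_edges G p `` {i}"

definition valid_problem :: "gcn_problem \<Rightarrow> bool"
  where "valid_problem G \<longleftrightarrow>
    finite (nodes G) \<and> edges G \<subseteq> nodes G \<times> nodes G \<and> sym (edges G) \<and>
    machines G \<ge> 1 \<and>
    (\<Union>p\<in>{1..machines G}. part_nodes G p) = nodes G \<and>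
    disjoint_family_on (part_nodes G) {1..machines G} \<and>
    (\<forall>p\<in>{1..machines G}.
       part_nodes G p \<noteq> {} \<and>
       part_edges G p \<subseteq> edges G \<inter> part_nodes G p \<times> part_nodes G p \<and> sym (part_edges G p) \<and>
       (\<forall>(B, nb)\<in>set_pmf (local_batch G p). B \<noteq> {} \<and> B \<subseteq> part_nodes G p \<and>
          (\<forall>l i. nb l i \<subseteq> (if l \<in> {1..depth G} then part_nbrs G p i else {}))) \<and>
       (\<forall>B\<in>set_pmf (full_batch G p). B \<noteq> {} \<and> B \<subseteq> part_nodes G p))"

primrec hidden ::
  "gcn_problem \<Rightarrow> (nat \<Rightarrow> nat \<Rightarrow> nat set) \<Rightarrow> weights \<Rightarrow> nat \<Rightarrow> nat \<Rightarrow> nat \<Rightarrow> real"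
  where
    "hidden G nb \<theta> 0 = (\<lambda>i a. if a < width G 0 then features G i a else 0)"
  | "hidden G nb \<theta> (Suc l) = (\<lambda>i b. if b < width G (Suc l)
       then activation G (1 / real (card (nb (Suc l) i)) *
         (\<Sum>j\<in>nb (Suc l) i. \<Sum>a<width G l. hidden G nb \<theta> l j a * Poly_Mapping.lookup \<theta> (Suc l, a, b)))
       else 0)"

definition batch_loss :: "gcn_problem \<Rightarrow> mini_batch \<Rightarrow> weights \<Rightarrow> real"
  where "batch_loss G \<xi> \<theta> =
    1 / real (card (fst \<xi>)) *
    (\<Sum>i\<in>fst \<xi>. node_loss G (hidden G (snd \<xi>) \<theta> (depth G) i) (labels G i))"

definition global_loss :: "gcn_problem \<Rightarrow> weights \<Rightarrow> real"
  where "global_loss G = batch_loss G (nodes G, \<lambda>l. nbrs G)"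

definition local_loss :: "gcn_problem \<Rightarrow> nat \<Rightarrow> weights \<Rightarrow> real"
  where "local_loss G p = batch_loss G (part_nodes G p, \<lambda>l. part_nbrs G p)"

definition full_loss :: "gcn_problem \<Rightarrow> nat \<Rightarrow> weights \<Rightarrow> real"
  where "full_loss G p = batch_loss G (part_nodes G p, \<lambda>l. nbrs G)"

definition stoch_grad :: "gcn_problem \<Rightarrow> mini_batch \<Rightarrow> weights \<Rightarrow> weights"
  where "stoch_grad G \<xi> = grad (batch_loss G \<xi>)"

text \<open>The mini-batch of a server step: sampled nodes, all neighbors in the whole graph.\<close>

definition full_mini_batch :: "gcn_problem \<Rightarrow> nat \<Rightarrow> mini_batch pmf"
  where "full_mini_batch G p = map_pmf (\<lambda>B. (B, \<lambda>l. nbrs G)) (full_batch G p)"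


section \<open>Learn Locally, Correct Globally\<close>

record llcg_params =
  rounds :: nat
  loc_K :: nat
  loc_\<rho> :: real
  corrections :: nat
  local_rate :: real
  server_rate :: real
  init :: weights

text \<open>
  \<open>K \<rho>\<^sup>r\<close>, the number of local steps in round \<open>r\<close>, is required to be a natural number below; the
  rounding only converts the type.
\<close>

definition local_count :: "llcg_params \<Rightarrow> nat \<Rightarrow> nat"
  where "local_count A r = nat \<lfloor>real (loc_K A) * loc_\<rho> A ^ r\<rfloor>"

definition valid_params :: "llcg_params \<Rightarrow> bool"
  where "valid_params A \<longleftrightarrow>
    rounds A \<ge> 1 \<and> loc_K A \<ge> 1 \<and> loc_\<rho> A > 1 \<and> corrections A \<ge> 1 \<and>
    (\<forall>r\<in>{1..rounds A}. real (loc_K A) * loc_\<rho> A ^ r \<in> \<nat>)"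

definition total_steps :: "llcg_params \<Rightarrow> nat"
  where "total_steps A = (\<Sum>r=1..rounds A. local_count A r) + corrections A * rounds A"

definition local_steps :: "llcg_params \<Rightarrow> nat \<Rightarrow> nat set"
  where "local_steps A r =
    {k + (\<Sum>j=1..<r. local_count A j) + corrections A * (r - 1) |k. k \<in> {1..local_count A r}}"

definition global_steps :: "llcg_params \<Rightarrow> nat \<Rightarrow> nat set"
  where "global_steps A r =
    {s + (\<Sum>j=1..r. local_count A j) + corrections A * (r - 1) |s. s \<in> {1..corrections A}}"

definition is_local :: "llcg_params \<Rightarrow> nat \<Rightarrow> bool"
  where "is_local A t \<longleftrightarrow> (\<exists>r\<in>{1..rounds A}. t \<in> local_steps A r)"

definition average :: "gcn_problem \<Rightarrow> (nat \<Rightarrow> weights) \<Rightarrow> weights"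
  where "average G w = (1 / real (machines G)) *\<^sub>R (\<Sum>p=1..machines G. w p)"

text \<open>
  Parameters of all machines at step \<open>t\<close>, given the mini-batch \<open>\<omega> (t, p)\<close> that machine \<open>p\<close> draws (or
  that is drawn from its nodes by the server) in step \<open>t\<close>. Steps are counted from 1, so that the
  initial parameters are those of step 1. A last local step of a round is followed by averaging.
\<close>

primrec iterates ::
  "gcn_problem \<Rightarrow> llcg_params \<Rightarrow> (nat \<times> nat \<Rightarrow> mini_batch) \<Rightarrow> nat \<Rightarrow> nat \<Rightarrow> weights"
  where
    "iterates G A \<omega> 0 = (\<lambda>p. init A)"
  | "iterates G A \<omega> (Suc t) =
      (let \<theta> = iterates G A \<omega> t;
           local_update = (\<lambda>p. \<theta> p - local_rate A *\<^sub>R stoch_grad G (\<omega> (t, p)) (\<theta> p));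
           server_update = average G \<theta> -
             server_rate A *\<^sub>R average G (\<lambda>p. stoch_grad G (\<omega> (t, p)) (average G \<theta>))
       in if t = 0 then (\<lambda>p. init A)
          else if is_local A t then
            (if is_local A (Suc t) then local_update else (\<lambda>p. average G local_update))
          else (\<lambda>p. server_update))"

definition avg_iterate ::
  "gcn_problem \<Rightarrow> llcg_params \<Rightarrow> (nat \<times> nat \<Rightarrow> mini_batch) \<Rightarrow> nat \<Rightarrow> weights"
  where "avg_iterate G A \<omega> t = average G (iterates G A \<omega> t)"

text \<open>The joint distribution of all mini-batches of a run: independent over steps and machines.\<close>

definition batches :: "gcn_problem \<Rightarrow> llcg_params \<Rightarrow> (nat \<times> nat \<Rightarrow> mini_batch) pmf"
  where "batches G A =
    Pi_pmf ({1..total_steps A} \<times> {1..machines G}) ({}, \<lambda>l i. {})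
      (\<lambda>(t, p). if is_local A t then local_batch G p else full_mini_batch G p)"

definition exp_global_grad :: "gcn_problem \<Rightarrow> llcg_params \<Rightarrow> nat \<Rightarrow> real"
  where "exp_global_grad G A t =
    measure_pmf.expectation (batches G A)
      (\<lambda>\<omega>. (norm (grad (global_loss G) (avg_iterate G A \<omega> t)))\<^sup>2)"

definition exp_local_grad :: "gcn_problem \<Rightarrow> llcg_params \<Rightarrow> nat \<Rightarrow> real"
  where "exp_local_grad G A t =
    measure_pmf.expectation (batches G A)
      (\<lambda>\<omega>. (norm (average G (\<lambda>p. grad (local_loss G p) (iterates G A \<omega> t p))))\<^sup>2)"

definition G_global :: "gcn_problem \<Rightarrow> llcg_params \<Rightarrow> nat \<Rightarrow> real"
  where "G_global G A r = Min (exp_global_grad G A ` global_steps A r)"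

definition G_local :: "gcn_problem \<Rightarrow> llcg_params \<Rightarrow> nat \<Rightarrow> real"
  where "G_local G A r = Min (exp_local_grad G A ` local_steps A r)"


section \<open>Assumptions on the stochastic gradients and on the partition\<close>

definition local_grad_assm :: "gcn_problem \<Rightarrow> real \<Rightarrow> real \<Rightarrow> bool"
  where "local_grad_assm G \<sigma>var \<sigma>bias \<longleftrightarrow>
    (\<forall>p\<in>{1..machines G}. \<forall>\<theta>.
      measure_pmf.expectation (local_batch G p)
        (\<lambda>\<xi>. (norm (stoch_grad G \<xi> \<theta> - vmean (local_batch G p) (\<lambda>\<xi>'. stoch_grad G \<xi>' \<theta>)))\<^sup>2)
        \<le> \<sigma>var\<^sup>2 \<and>
      (norm (vmean (local_batch G p) (\<lambda>\<xi>. stoch_grad G \<xi> \<theta>) - grad (local_loss G p) \<theta>))\<^sup>2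
        \<le> \<sigma>bias\<^sup>2)"

definition full_grad_assm :: "gcn_problem \<Rightarrow> real \<Rightarrow> bool"
  where "full_grad_assm G \<sigma>global \<longleftrightarrow>
    (\<forall>p\<in>{1..machines G}. \<forall>\<theta>.
      measure_pmf.expectation (full_mini_batch G p)
        (\<lambda>\<xi>. (norm (stoch_grad G \<xi> \<theta> - grad (full_loss G p) \<theta>))\<^sup>2) \<le> \<sigma>global\<^sup>2)"

definition server_unbiased :: "gcn_problem \<Rightarrow> bool"
  where "server_unbiased G \<longleftrightarrow>
    (\<forall>\<theta>. (\<forall>p\<in>{1..machines G}.
            vmean (full_mini_batch G p) (\<lambda>\<xi>. stoch_grad G \<xi> \<theta>) = grad (full_loss G p) \<theta>) \<and>
         average G (\<lambda>p. grad (full_loss G p) \<theta>) = grad (global_loss G) \<theta>)"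

definition discrepancy_bound :: "gcn_problem \<Rightarrow> real \<Rightarrow> real \<Rightarrow> bool"
  where "discrepancy_bound G \<kappa>A \<kappa>X \<longleftrightarrow>
    (\<forall>p\<in>{1..machines G}. \<forall>\<theta>.
      (norm (grad (local_loss G p) \<theta> - grad (full_loss G p) \<theta>))\<^sup>2 \<le> \<kappa>A\<^sup>2 \<and>
      (norm (grad (full_loss G p) \<theta> - grad (global_loss G) \<theta>))\<^sup>2 \<le> \<kappa>X\<^sup>2)"

end

theory Submission
  imports Defs
begin

text \<open>
  Let \<open>a = \<eta> L\<close>, let \<open>g\<close> be the global gradient at the average iterate and \<open>u\<close> the average of the local
  gradients. The descent lemma bounds the expected decrease of the loss in a local step from below by
  \<open>\<eta>/2\<close> times \<open>|g|\<^sup>2/4 + (1 - a) |u|\<^sup>2 - (\<kappa>\<^sup>2 + 2 \<sigma>bias\<^sup>2)\<close>, up to a variance term and a drift term, and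
  in a server step by \<open>\<eta>/2\<close> times \<open>|g|\<^sup>2 + (1 - a) |g|\<^sup>2\<close>, up to a variance term. The number of
  correction steps is chosen such that in every round the terms with the factor \<open>1 - a\<close> compensate
  \<open>\<kappa>\<^sup>2 + 2 \<sigma>bias\<^sup>2\<close>. The drift term of a step in round \<open>r\<close> is of first order, namely
  \<open>\<eta> L K \<rho>\<^sup>r\<close>, because the local parameters stay within mean square distance \<open>O(\<eta> K \<rho>\<^sup>r)\<close> of their
  average; its sum over all steps is of order \<open>\<eta> \<Sum> K\<^sup>2 \<rho>\<^sup>2\<^sup>r\<close>.
\<close>

subsection \<open>Inner product spaces\<close>

text \<open>Young's inequality. The weight \<open>c\<close> stays free: the drift recursion uses
  \<open>c = 1 / n\<close>, so that the growth over \<open>n\<close> steps stays bounded, and the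
  gradient gap uses \<open>c = s\<close>, so that the main coefficient tends to 1 with
  \<open>s\<close>.\<close>

lemma norm_add_sq_le:
  fixes x y :: "'a::real_inner"
  assumes "c > 0"
  shows "(norm (x + y))\<^sup>2 \<le> (1 + c) * (norm x)\<^sup>2 + (1 + 1 / c) * (norm y)\<^sup>2"
proof -
  have "0 \<le> (norm (c *\<^sub>R x - y))\<^sup>2" by simp
  also have "\<dots> = c\<^sup>2 * (norm x)\<^sup>2 - 2 * c * (x \<bullet> y) + (norm y)\<^sup>2"
    unfolding power2_norm_eq_inner
    by (simp add: inner_diff_left inner_diff_right inner_commute power2_eq_square algebra_simps)
  finally have "2 * c * (x \<bullet> y) / c \<le> (c\<^sup>2 * (norm x)\<^sup>2 + (norm y)\<^sup>2) / c"
    using assms by (intro divide_right_mono) auto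
  then have "2 * (x \<bullet> y) \<le> c * (norm x)\<^sup>2 + (norm y)\<^sup>2 / c"
    using assms by (simp add: add_divide_distrib power2_eq_square)
  moreover have "(norm (x + y))\<^sup>2 = (norm x)\<^sup>2 + 2 * (x \<bullet> y) + (norm y)\<^sup>2"
    by (simp add: power2_norm_eq_inner inner_add_left inner_add_right inner_commute)
  ultimately show ?thesis by (simp add: algebra_simps)
qed

text \<open>The difference of the two sides is the sum of the ten squared pairwise
  distances.\<close>

lemma norm_add5_sq_le:
  fixes a b c d e :: "'a::real_inner"
  shows "(norm (a + b + c + d + e))\<^sup>2 \<le>
    5 * ((norm a)\<^sup>2 + (norm b)\<^sup>2 + (norm c)\<^sup>2 + (norm d)\<^sup>2 + (norm e)\<^sup>2)"
proof -
  have "0 \<le> (norm (a - b))\<^sup>2 + (norm (a - c))\<^sup>2 + (norm (a - d))\<^sup>2 + (norm (a - e))\<^sup>2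
    + (norm (b - c))\<^sup>2 + (norm (b - d))\<^sup>2 + (norm (b - e))\<^sup>2
    + (norm (c - d))\<^sup>2 + (norm (c - e))\<^sup>2 + (norm (d - e))\<^sup>2" by simp
  then show ?thesis
    by (simp add: power2_norm_eq_inner inner_add_left inner_add_right inner_diff_left
        inner_diff_right inner_commute)
qed

lemma norm_mean_sq_le:
  fixes x :: "'i \<Rightarrow> 'a::real_inner"
  shows "(norm ((1 / real (card I)) *\<^sub>R (\<Sum>i\<in>I. x i)))\<^sup>2 \<le> 1 / real (card I) * (\<Sum>i\<in>I. (norm (x i))\<^sup>2)"
proof (cases "card I = 0")
  case False
  have "(norm (\<Sum>i\<in>I. x i))\<^sup>2 \<le> (\<Sum>i\<in>I. norm (x i))\<^sup>2"
    by (intro power_mono norm_sum) auto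
  also have "\<dots> \<le> (\<Sum>i\<in>I. (norm (x i))\<^sup>2) * card I"
    by (rule sum_squared_le_sum_of_squares)
  finally show ?thesis
    using False by (simp add: power_mult_distrib field_simps power2_eq_square)
qed auto

text \<open>The deviations from the mean sum to zero, so the cross term in the expansion around the
  mean vanishes. In the drift bound this replaces the mean of the stochastic gradients by the global
  gradient.\<close>

lemma sum_norm_sq_diff_mean_le:
  fixes x :: "'i \<Rightarrow> 'a::real_inner"
  assumes "finite I" "I \<noteq> {}"
  shows "(\<Sum>i\<in>I. (norm (x i - (1 / real (card I)) *\<^sub>R (\<Sum>i\<in>I. x i)))\<^sup>2) \<le> (\<Sum>i\<in>I. (norm (x i - z))\<^sup>2)"
proof -
  define m where "m = (1 / real (card I)) *\<^sub>R (\<Sum>i\<in>I. x i)"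
  have card: "card I > 0" using assms by (simp add: card_gt_0_iff)
  then have sum: "(\<Sum>i\<in>I. x i) = real (card I) *\<^sub>R m" by (simp add: m_def)
  have "(\<Sum>i\<in>I. (norm (x i - z))\<^sup>2) =
    (\<Sum>i\<in>I. (norm (x i - m))\<^sup>2 + 2 * ((x i - m) \<bullet> (m - z)) + (norm (m - z))\<^sup>2)"
    by (intro sum.cong refl)
      (simp add: power2_norm_eq_inner inner_diff_left inner_diff_right inner_commute)
  also have "\<dots> = (\<Sum>i\<in>I. (norm (x i - m))\<^sup>2) + 2 * ((\<Sum>i\<in>I. x i - m) \<bullet> (m - z))
      + real (card I) * (norm (m - z))\<^sup>2"
    by (simp add: sum.distrib sum_distrib_left inner_sum_left)
  also have "(\<Sum>i\<in>I. x i - m) = 0"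
    by (simp add: sum_subtractf sum sum_constant_scaleR)
  finally show ?thesis by (simp add: m_def)
qed

section \<open>Smooth functions and the descent inequality\<close>

lemma smooth_with_GDERIV:
  assumes "smooth_with L f"
  shows "GDERIV f x :> grad f x"
  using assms grad_eqI unfolding smooth_with_def by metis

lemma smooth_with_le:
  assumes "smooth_with L f"
  shows "norm (grad f x - grad f y) \<le> L * norm (x - y)"
  using assms unfolding smooth_with_def by blast

text \<open>On the segment from \<open>x\<close> to \<open>x + d\<close>, the function minus its
  quadratic upper model, called \<open>h\<close>, has a nonpositive derivative by Cauchy-Schwarz and
  the Lipschitz bound. Monotonicity of a real function takes the place of an integral of the
  gradient.\<close>

lemma smooth_with_descent:
  assumes "smooth_with L f"
  shows "f (x + d) \<le> f x + grad f x \<bullet> d + L / 2 * (norm d)\<^sup>2"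
proof -
  define h where "h s = f (x + s *\<^sub>R d) - s * (grad f x \<bullet> d) - L / 2 * s\<^sup>2 * (norm d)\<^sup>2" for s :: real
  have *: "\<exists>y. (h has_real_derivative y) (at s) \<and> y \<le> 0" if "0 \<le> s" for s
  proof (intro exI conjI)
    have 1: "((\<lambda>s. x + s *\<^sub>R d) has_derivative (\<lambda>r. r *\<^sub>R d)) (at s)"
      by (auto intro!: derivative_eq_intros)
    have "((f \<circ> (\<lambda>s. x + s *\<^sub>R d)) has_derivative
        ((\<lambda>v. v \<bullet> grad f (x + s *\<^sub>R d)) \<circ> (\<lambda>r. r *\<^sub>R d))) (at s)"
      using smooth_with_GDERIV[OF assms, of "x + s *\<^sub>R d"]
      by (intro diff_chain_at 1) (simp add: gderiv_def)
    then have "((\<lambda>s. f (x + s *\<^sub>R d)) has_real_derivative d \<bullet> grad f (x + s *\<^sub>R d)) (at s)"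
      unfolding o_def by (rule has_derivative_imp_has_field_derivative) simp
    then show "(h has_real_derivative d \<bullet> grad f (x + s *\<^sub>R d) - grad f x \<bullet> d - L * s * (norm d)\<^sup>2) (at s)"
      unfolding h_def by (auto intro!: derivative_eq_intros)
    have "d \<bullet> grad f (x + s *\<^sub>R d) - grad f x \<bullet> d = d \<bullet> (grad f (x + s *\<^sub>R d) - grad f x)"
      by (simp add: inner_diff_right inner_commute)
    also have "\<dots> \<le> norm d * norm (grad f (x + s *\<^sub>R d) - grad f x)"
      by (rule norm_cauchy_schwarz)
    also have "\<dots> \<le> norm d * (L * norm (x + s *\<^sub>R d - x))"
      by (intro mult_left_mono smooth_with_le assms) auto
    finally show "d \<bullet> grad f (x + s *\<^sub>R d) - grad f x \<bullet> d - L * s * (norm d)\<^sup>2 \<le> 0"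
      using that by (simp add: power2_eq_square algebra_simps)
  qed
  have "h 1 \<le> h 0"
    by (rule DERIV_nonpos_imp_nonincreasing[of 0 1 h]) (simp, rule *)
  then show ?thesis by (simp add: h_def)
qed

text \<open>
  The coefficients of \<open>(norm u)\<^sup>2\<close> and \<open>\<beta>\<^sup>2\<close> have to be exactly \<open>1 - a\<close> and \<open>2\<close>, since these terms
  are cancelled by the correction steps. The cross term of \<open>b\<close> and \<open>g - u\<close> of size \<open>a\<close> is moved
  into the term of size \<open>a\<^sup>2\<close>, using the slack in \<open>2 * \<beta>\<^sup>2\<close>.
\<close>

lemma biased_descent_bound:
  fixes g u b :: "'a::real_inner"
  assumes a: "0 \<le> a" "a \<le> 1" and b: "(norm b)\<^sup>2 \<le> \<beta>\<^sup>2"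
  shows "- 2 * (g \<bullet> (u + b)) + a * (norm (u + b))\<^sup>2
    \<le> (1 + 3 / 2 * a\<^sup>2) * (norm (g - u))\<^sup>2 - (norm g)\<^sup>2 / 4 - (1 - a) * (norm u)\<^sup>2 + 2 * \<beta>\<^sup>2"
proof -
  define v where "v = u - g"
  have u: "u = g + v" by (simp add: v_def)
  define gg gv gb vv vb bb where "gg = g \<bullet> g" "gv = g \<bullet> v" "gb = g \<bullet> b" "vv = v \<bullet> v"
    "vb = v \<bullet> b" "bb = b \<bullet> b"
  note defs = gg_gv_gb_vv_vb_bb_def
  \<comment> \<open>Two thirds of this inequality absorb the product \<open>vb\<close>, and one
    twelfth of the next absorbs \<open>gb\<close>. By fact \<open>3\<close> the total weight of
    \<open>bb\<close>, including the term \<open>a * bb\<close> of the left side, is at most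
    \<open>2 - a / 3\<close>, hence at most the allowed 2.\<close>
  have 1: "0 \<le> 9 / 4 * a\<^sup>2 * vv - 3 * a * vb + bb"
    using inner_ge_zero[of "(3 / 2 * a) *\<^sub>R v - b"]
    by (simp add: defs inner_diff_left inner_diff_right inner_commute power2_eq_square algebra_simps)
  have 2: "0 \<le> 9 * gg + 24 * (1 - a) * gb + 16 * (1 - a)\<^sup>2 * bb"
    using inner_ge_zero[of "3 *\<^sub>R g + (4 * (1 - a)) *\<^sub>R b"]
    by (simp add: defs inner_add_left inner_add_right inner_commute power2_eq_square algebra_simps)
  have bb: "0 \<le> bb" by (simp add: defs)
  have "(1 - a)\<^sup>2 \<le> 1 - a"
    using a by (simp add: power2_eq_square mult_left_le)
  then have 3: "(1 - a)\<^sup>2 * bb \<le> (1 - a) * bb" using bb by (rule mult_right_mono)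
  have 4: "0 \<le> a * bb" using a bb by simp
  have b': "bb \<le> \<beta>\<^sup>2" using b by (simp add: defs power2_norm_eq_inner)
  have "- 2 * (g \<bullet> (u + b)) + a * (norm (u + b))\<^sup>2 =
    - 2 * gg - 2 * gv - 2 * gb + a * (gg + 2 * gv + vv + 2 * gb + 2 * vb + bb)"
    by (simp add: defs u power2_norm_eq_inner inner_add_left inner_add_right inner_commute algebra_simps)
  also have "\<dots> \<le> (1 + 3 / 2 * a\<^sup>2) * vv - gg / 4 - (1 - a) * (gg + 2 * gv + vv) + 2 * \<beta>\<^sup>2"
    using 1 2 3 4 b' by (simp add: algebra_simps)
  also have "\<dots> = (1 + 3 / 2 * a\<^sup>2) * (norm (g - u))\<^sup>2 - (norm g)\<^sup>2 / 4 - (1 - a) * (norm u)\<^sup>2 + 2 * \<beta>\<^sup>2"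
    by (simp add: defs u power2_norm_eq_inner inner_add_left inner_add_right inner_commute algebra_simps)
  finally show ?thesis .
qed

subsection \<open>Finitely supported distributions\<close>

lemma integrable_finite_pmf:
  fixes f :: "'b \<Rightarrow> real"
  assumes "finite (set_pmf M)"
  shows "integrable (measure_pmf M) f"
  using assms by (rule integrable_measure_pmf_finite)

lemma expectation_eq_sum:
  fixes f :: "'b \<Rightarrow> real"
  assumes "finite (set_pmf M)"
  shows "measure_pmf.expectation M f = (\<Sum>x\<in>set_pmf M. pmf M x * f x)"
  using assms by (subst integral_measure_pmf[of "set_pmf M"]) auto

lemma expectation_inner_vmean:
  fixes f :: "'b \<Rightarrow> 'a::real_inner"
  assumes "finite (set_pmf M)"
  shows "measure_pmf.expectation M (\<lambda>x. f x \<bullet> z) = vmean M f \<bullet> z"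
  using assms by (simp add: expectation_eq_sum vmean_def inner_sum_left)

lemma vmean_diff_const:
  fixes f :: "'b \<Rightarrow> 'a::real_vector"
  assumes "finite (set_pmf M)"
  shows "vmean M (\<lambda>x. f x - c) = vmean M f - c"
  using assms sum_pmf_eq_1[of "set_pmf M" M]
  by (simp add: vmean_def scaleR_diff_right sum_subtractf flip: scaleR_left.sum)

text \<open>Independence lets coordinate \<open>i\<close> be drawn last, which gives
  \<open>*\<close>. Applying \<open>*\<close> also to the inner expectation changes nothing, because
  overwriting \<open>i\<close> twice keeps only the last value. The lemma plays the role of
  conditioning on all other coordinates.\<close>

lemma expectation_Pi_pmf_resample:
  fixes f :: "('i \<Rightarrow> 'b) \<Rightarrow> real"
  assumes I: "finite I" "i \<in> I" and fin: "\<And>j. j \<in> I \<Longrightarrow> finite (set_pmf (q j))"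
  shows "measure_pmf.expectation (Pi_pmf I d q) f =
    measure_pmf.expectation (Pi_pmf I d q) (\<lambda>w. measure_pmf.expectation (q i) (\<lambda>\<xi>. f (w(i := \<xi>))))"
proof -
  define J where "J = I - {i}"
  have J: "finite J" "i \<notin> J" "I = insert i J" using I by (auto simp: J_def)
  have fJ: "finite (set_pmf (Pi_pmf J d q))"
    using J fin by (subst set_Pi_pmf) auto
  have *: "measure_pmf.expectation (Pi_pmf I d q) h =
    measure_pmf.expectation (Pi_pmf J d q) (\<lambda>w. measure_pmf.expectation (q i) (\<lambda>\<xi>. h (w(i := \<xi>))))"
    for h :: "('i \<Rightarrow> 'b) \<Rightarrow> real"
  proof -
    have "Pi_pmf I d q = Pi_pmf J d q \<bind> (\<lambda>w. map_pmf (\<lambda>\<xi>. w(i := \<xi>)) (q i))"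
      unfolding J(3) Pi_pmf_insert'[OF J(1,2)] map_pmf_def by (rule bind_commute_pmf)
    then show ?thesis
      using fJ fin[OF I(2)]
      by (simp add: pmf_expectation_bind[of "set_pmf (Pi_pmf J d q)"] expectation_eq_sum[OF fJ])
  qed
  show ?thesis
    unfolding *[of f] *[of "\<lambda>w. measure_pmf.expectation (q i) (\<lambda>\<xi>. f (w(i := \<xi>)))"] by simp
qed

text \<open>Averaging over coordinate \<open>i\<close> first leaves the inner product of a zero mean
  with \<open>Z\<close>, which is constant in that coordinate.\<close>

lemma expectation_Pi_pmf_inner_eq_0:
  fixes X Z :: "('i \<Rightarrow> 'b) \<Rightarrow> 'a::real_inner"
  assumes "finite I" "i \<in> I" "\<And>j. j \<in> I \<Longrightarrow> finite (set_pmf (q j))"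
    and "\<And>w. vmean (q i) (\<lambda>\<xi>. X (w(i := \<xi>))) = 0" "\<And>w \<xi>. Z (w(i := \<xi>)) = Z w"
  shows "measure_pmf.expectation (Pi_pmf I d q) (\<lambda>w. X w \<bullet> Z w) = 0"
  using assms by (subst expectation_Pi_pmf_resample[of I i]) (simp_all add: expectation_inner_vmean)

text \<open>Orthogonality removes the off-diagonal terms of the double sum, so \<open>card I\<close>
  terms stand against the squared factor \<open>1 / card I\<close>. With one summand per machine
  this is the variance reduction by the number of machines.\<close>

lemma expectation_norm_sq_mean_le:
  fixes X :: "'i \<Rightarrow> 'b \<Rightarrow> 'a::real_inner"
  assumes fin: "finite (set_pmf M)"
    and orth: "\<And>i j. i \<in> I \<Longrightarrow> j \<in> I \<Longrightarrow> i \<noteq> j \<Longrightarrow> measure_pmf.expectation M (\<lambda>w. X i w \<bullet> X j w) = 0"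
    and var: "\<And>i. i \<in> I \<Longrightarrow> measure_pmf.expectation M (\<lambda>w. (norm (X i w))\<^sup>2) \<le> s"
  shows "measure_pmf.expectation M (\<lambda>w. (norm ((1 / real (card I)) *\<^sub>R (\<Sum>i\<in>I. X i w)))\<^sup>2) \<le> s / real (card I)"
proof (cases "card I = 0")
  case False
  then have I: "finite I" by (simp add: card_ge_0_finite)
  have "measure_pmf.expectation M (\<lambda>w. (norm (\<Sum>i\<in>I. X i w))\<^sup>2) =
    (\<Sum>i\<in>I. \<Sum>j\<in>I. measure_pmf.expectation M (\<lambda>w. X i w \<bullet> X j w))"
    unfolding power2_norm_eq_inner inner_sum_left
    unfolding inner_sum_right by (simp add: integrable_finite_pmf fin)
  also have "\<dots> = (\<Sum>i\<in>I. \<Sum>j\<in>I. if i = j then measure_pmf.expectation M (\<lambda>w. (norm (X i w))\<^sup>2) else 0)"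
    using orth by (intro sum.cong refl) (auto simp: power2_norm_eq_inner)
  also have "\<dots> = (\<Sum>i\<in>I. measure_pmf.expectation M (\<lambda>w. (norm (X i w))\<^sup>2))"
    using I by simp
  also have "\<dots> \<le> card I * s" using var sum_bounded_above[of I _ s] by simp
  finally have *: "measure_pmf.expectation M (\<lambda>w. (norm (\<Sum>i\<in>I. X i w))\<^sup>2) \<le> card I * s" .
  have "measure_pmf.expectation M (\<lambda>w. (norm ((1 / real (card I)) *\<^sub>R (\<Sum>i\<in>I. X i w)))\<^sup>2) =
    (1 / real (card I))\<^sup>2 * measure_pmf.expectation M (\<lambda>w. (norm (\<Sum>i\<in>I. X i w))\<^sup>2)"
    by (simp add: power_mult_distrib power_divide)
  also have "\<dots> \<le> (1 / real (card I))\<^sup>2 * (card I * s)" by (intro mult_left_mono *) auto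
  also have "\<dots> = s / card I" using False by (simp add: power2_eq_square)
  finally show ?thesis .
qed auto

text \<open>The direction is split into a mean \<open>m\<close> and noise \<open>N\<close>. Noise
  orthogonal to the gradient and to \<open>m\<close> contributes only through its second moment, at
  order \<open>\<eta>\<^sup>2\<close>. Local and server steps are both instances.\<close>

lemma expectation_smooth_descent:
  fixes f :: "'a::real_inner \<Rightarrow> real"
  assumes fin: "finite (set_pmf M)" and f: "smooth_with L f" "0 \<le> L"
    and N: "measure_pmf.expectation M (\<lambda>w. N w \<bullet> grad f (x w)) = 0"
      "measure_pmf.expectation M (\<lambda>w. N w \<bullet> m w) = 0"
      "measure_pmf.expectation M (\<lambda>w. (norm (N w))\<^sup>2) \<le> s"
  shows "measure_pmf.expectation M (\<lambda>w. f (x w - \<eta> *\<^sub>R (m w + N w)))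
    \<le> measure_pmf.expectation M (\<lambda>w. f (x w))
      + \<eta> / 2 * measure_pmf.expectation M (\<lambda>w. - 2 * (grad f (x w) \<bullet> m w) + \<eta> * L * (norm (m w))\<^sup>2)
      + L / 2 * \<eta>\<^sup>2 * s"
proof -
  note int = integrable_finite_pmf[OF fin]
  have "f (x w - \<eta> *\<^sub>R (m w + N w)) \<le> f (x w)
      + \<eta> / 2 * (- 2 * (grad f (x w) \<bullet> m w) + \<eta> * L * (norm (m w))\<^sup>2)
      + (- \<eta> * (N w \<bullet> grad f (x w)) + L * \<eta>\<^sup>2 * (N w \<bullet> m w) + L / 2 * \<eta>\<^sup>2 * (norm (N w))\<^sup>2)" for w
    using smooth_with_descent[OF f(1), of "x w" "- \<eta> *\<^sub>R (m w + N w)"]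
    unfolding power2_norm_eq_inner
    by (simp add: inner_add_left inner_add_right inner_commute power2_eq_square algebra_simps)
  then have "measure_pmf.expectation M (\<lambda>w. f (x w - \<eta> *\<^sub>R (m w + N w)))
    \<le> measure_pmf.expectation M (\<lambda>w. f (x w)
      + \<eta> / 2 * (- 2 * (grad f (x w) \<bullet> m w) + \<eta> * L * (norm (m w))\<^sup>2)
      + (- \<eta> * (N w \<bullet> grad f (x w)) + L * \<eta>\<^sup>2 * (N w \<bullet> m w) + L / 2 * \<eta>\<^sup>2 * (norm (N w))\<^sup>2))"
    by (intro integral_mono int)
  also have "\<dots> = measure_pmf.expectation M (\<lambda>w. f (x w))
      + \<eta> / 2 * measure_pmf.expectation M (\<lambda>w. - 2 * (grad f (x w) \<bullet> m w) + \<eta> * L * (norm (m w))\<^sup>2)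
      + L / 2 * \<eta>\<^sup>2 * measure_pmf.expectation M (\<lambda>w. (norm (N w))\<^sup>2)"
    using N(1,2) by (simp add: int)
  also have "L / 2 * \<eta>\<^sup>2 * measure_pmf.expectation M (\<lambda>w. (norm (N w))\<^sup>2) \<le> L / 2 * \<eta>\<^sup>2 * s"
    using f(2) by (intro mult_left_mono N(3)) auto
  finally show ?thesis by simp
qed

subsection \<open>The schedule\<close>

text \<open>The number of steps before round \<open>r\<close>, so that the round begins with step
  \<open>Suc (round_start A r)\<close>. With this offset both kinds of steps form intervals.\<close>

definition round_start :: "llcg_params \<Rightarrow> nat \<Rightarrow> nat"
  where "round_start A r = (\<Sum>j=1..<r. local_count A j) + corrections A * (r - 1)"

lemma round_start_1 [simp]: "round_start A (Suc 0) = 0"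
  by (simp add: round_start_def)

lemma round_start_Suc:
  "r \<ge> 1 \<Longrightarrow> round_start A (Suc r) = round_start A r + local_count A r + corrections A"
  by (cases r) (auto simp: round_start_def)

lemma round_start_rounds: "round_start A (Suc (rounds A)) = total_steps A"
  by (simp add: round_start_def total_steps_def atLeastLessThanSuc_atLeastAtMost)

lemma round_start_mono:
  assumes "1 \<le> r" "r \<le> r'"
  shows "round_start A r \<le> round_start A r'"
  using assms(2)
proof (induction r' rule: dec_induct)
  case (step n)
  then show ?case using assms(1) round_start_Suc[of n A] by simp
qed simp

lemma local_steps_eq:
  "local_steps A r = {Suc (round_start A r)..round_start A r + local_count A r}"
proof -
  have "local_steps A r = (\<lambda>k. k + round_start A r) ` {1..local_count A r}"
    unfolding local_steps_def round_start_def Setcompr_eq_image by (simp only: add.assoc)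
  then show ?thesis by (simp add: add.commute)
qed

lemma global_steps_eq:
  assumes "r \<ge> 1"
  shows "global_steps A r =
    {Suc (round_start A r + local_count A r)..round_start A r + local_count A r + corrections A}"
proof -
  have "(\<Sum>j=1..r. local_count A j) = (\<Sum>j=1..<r. local_count A j) + local_count A r"
    using assms by (metis sum.last_plus add.commute)
  then have "global_steps A r =
      (\<lambda>k. k + (round_start A r + local_count A r)) ` {1..corrections A}"
    unfolding global_steps_def round_start_def Setcompr_eq_image by (simp only: ac_simps)
  then show ?thesis by (simp add: add.commute add.left_commute)
qed

lemma sum_steps:
  fixes f :: "nat \<Rightarrow> real"
  shows "(\<Sum>t=1..total_steps A. f t) =
    (\<Sum>r=1..rounds A. (\<Sum>t\<in>local_steps A r. f t) + (\<Sum>t\<in>global_steps A r. f t))"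
proof -
  have "(\<Sum>t=1..round_start A (Suc R). f t) =
    (\<Sum>r=1..R. (\<Sum>t\<in>local_steps A r. f t) + (\<Sum>t\<in>global_steps A r. f t))" for R
  proof (induction R)
    case (Suc R)
    have "(\<Sum>t=1..round_start A (Suc (Suc R)). f t) = (\<Sum>t=1..round_start A (Suc R). f t)
        + (\<Sum>t\<in>local_steps A (Suc R). f t) + (\<Sum>t\<in>global_steps A (Suc R). f t)"
      using sum.ub_add_nat[of 1 "round_start A (Suc R)" f "local_count A (Suc R)"]
        sum.ub_add_nat[of 1 "round_start A (Suc R) + local_count A (Suc R)" f "corrections A"]
      by (simp add: round_start_Suc local_steps_eq global_steps_eq)
    then show ?case using Suc by simp
  qed simp
  then show ?thesis by (metis round_start_rounds)
qed

lemma global_steps_not_local: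
  assumes "r \<ge> 1" "t \<in> global_steps A r"
  shows "\<not> is_local A t"
proof
  assume "is_local A t"
  then obtain r' where r': "r' \<ge> 1" "t \<in> local_steps A r'" by (auto simp: is_local_def)
  have "Suc r \<le> r' \<or> r' = r \<or> Suc r' \<le> r" by linarith
  then show False
    using assms r' round_start_mono[of "Suc r" r' A] round_start_mono[of "Suc r'" r A]
    by (auto simp: local_steps_eq global_steps_eq round_start_Suc)
qed

lemma steps_subset:
  assumes "r \<in> {1..rounds A}"
  shows "local_steps A r \<subseteq> {1..total_steps A}" "global_steps A r \<subseteq> {1..total_steps A}"
  using assms round_start_mono[of "Suc r" "Suc (rounds A)" A]
  by (auto simp: local_steps_eq global_steps_eq round_start_Suc round_start_rounds)

lemma real_local_count:
  assumes "valid_params A" "r \<in> {1..rounds A}"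
  shows "real (local_count A r) = real (loc_K A) * loc_\<rho> A ^ r"
proof -
  have "real (loc_K A) * loc_\<rho> A ^ r \<in> \<nat>" using assms by (auto simp: valid_params_def)
  then obtain m where "real (loc_K A) * loc_\<rho> A ^ r = real m" by (auto elim: Nats_cases)
  then show ?thesis by (simp add: local_count_def)
qed

text \<open>
  Since \<open>K \<rho>\<^sup>r\<close> is strictly increasing in \<open>r\<close> with natural values, it grows at least linearly. Hence
  the number of rounds is of order \<open>sqrt T\<close> at most, which the assumption on \<open>\<Sum> K\<^sup>2 \<rho>\<^sup>2\<^sup>r\<close>
  needs to control the drift.
\<close>

lemma local_count_ge:
  assumes "valid_params A" "r \<le> rounds A" "r \<ge> 1"
  shows "r \<le> local_count A r"
  using assms(3,2)
proof (induction r rule: dec_induct)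
  case base
  have "real (local_count A 1) > 0"
    using assms base by (subst real_local_count) (auto simp: valid_params_def)
  then show ?case by linarith
next
  case (step r)
  have "real (local_count A r) < real (local_count A (Suc r))"
    using assms step by (simp add: real_local_count) (simp add: valid_params_def)
  then show ?case using step by simp
qed

lemma rounds_sq_le:
  assumes "valid_params A"
  shows "(rounds A)\<^sup>2 \<le> 2 * total_steps A"
proof -
  have "(\<Sum>r=1..rounds A. r) \<le> (\<Sum>r=1..rounds A. local_count A r)"
    using local_count_ge[OF assms] by (intro sum_mono) auto
  also have "\<dots> \<le> total_steps A" by (simp add: total_steps_def)
  finally have "2 * (\<Sum>r=1..rounds A. r) \<le> 2 * total_steps A" by simp
  moreover have "2 * (\<Sum>r=1..n. r) = n\<^sup>2 + n" for n :: nat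
    by (induction n) (auto simp: power2_eq_square)
  from this[of "rounds A"] have "(rounds A)\<^sup>2 \<le> 2 * (\<Sum>r=1..rounds A. r)" by simp
  ultimately show ?thesis by (rule order_trans[rotated])
qed

subsection \<open>The iterates\<close>

text \<open>A mini-batch of step \<open>t\<close> first enters the parameters of step
  \<open>Suc t\<close>, so \<open>s = t\<close> is included. This makes the current mini-batch
  independent of the current parameters.\<close>

lemma iterates_upd:
  "s \<le> t \<Longrightarrow> iterates G A (w((t, p) := \<xi>)) s = iterates G A w s"
  by (induction s) (auto simp: Let_def)

lemma avg_iterate_upd:
  "s \<le> t \<Longrightarrow> avg_iterate G A (w((t, p) := \<xi>)) s = avg_iterate G A w s"
  by (simp add: avg_iterate_def iterates_upd)

lemma average_diff: "average G (\<lambda>p. x p - y p) = average G x - average G y"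
  by (simp add: average_def sum_subtractf scaleR_diff_right)

lemma average_scaleR: "average G (\<lambda>p. c *\<^sub>R x p) = c *\<^sub>R average G x"
  by (simp add: average_def flip: scaleR_right.sum)

lemma average_const: "machines G \<ge> 1 \<Longrightarrow> average G (\<lambda>p. x) = x"
  by (simp add: average_def sum_constant_scaleR del: sum_constant)

lemma norm_average_sq_le:
  "(norm (average G x))\<^sup>2 \<le> 1 / real (machines G) * (\<Sum>p=1..machines G. (norm (x p))\<^sup>2)"
  using norm_mean_sq_le[of "{1..machines G}" x] by (simp add: average_def)

lemma norm_average_sq_le_const:
  assumes "machines G \<ge> 1" "\<And>p. p \<in> {1..machines G} \<Longrightarrow> (norm (x p))\<^sup>2 \<le> c"
  shows "(norm (average G x))\<^sup>2 \<le> c"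
proof -
  have "(\<Sum>p=1..machines G. (norm (x p))\<^sup>2) \<le> real (machines G) * c"
    using assms(2) sum_bounded_above[of "{1..machines G}" "\<lambda>p. (norm (x p))\<^sup>2" c] by simp
  then have "1 / real (machines G) * (\<Sum>p=1..machines G. (norm (x p))\<^sup>2)
      \<le> 1 / real (machines G) * (real (machines G) * c)"
    by (rule mult_left_mono) simp
  then show ?thesis
    using norm_average_sq_le[of G x] assms(1) by simp
qed

lemma avg_iterate_1: "machines G \<ge> 1 \<Longrightarrow> avg_iterate G A w (Suc 0) = init A"
  by (simp add: avg_iterate_def average_const Let_def)

text \<open>The last local step of a round is covered too, because averaging the machines leaves
  their average unchanged.\<close>

lemma avg_iterate_local:
  assumes "machines G \<ge> 1" "t \<ge> 1" "is_local A t"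
  shows "avg_iterate G A w (Suc t) = avg_iterate G A w t
    - local_rate A *\<^sub>R average G (\<lambda>p. stoch_grad G (w (t, p)) (iterates G A w t p))"
  using assms
  by (simp add: avg_iterate_def average_const average_diff average_scaleR Let_def)

lemma avg_iterate_server:
  assumes "machines G \<ge> 1" "t \<ge> 1" "\<not> is_local A t"
  shows "avg_iterate G A w (Suc t) = avg_iterate G A w t
    - server_rate A *\<^sub>R average G (\<lambda>p. stoch_grad G (w (t, p)) (avg_iterate G A w t))"
  using assms by (simp add: avg_iterate_def average_const Let_def)

lemma iterates_local:
  assumes "t \<ge> 1" "is_local A t" "is_local A (Suc t)"
  shows "iterates G A w (Suc t) p = iterates G A w t p
    - local_rate A *\<^sub>R stoch_grad G (w (t, p)) (iterates G A w t p)"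
  using assms by (simp add: Let_def)

text \<open>In the first round all machines hold \<open>init A\<close>. In later rounds the
  preceding step is a correction step, which exists because \<open>corrections A\<close> is positive
  and which hands the same parameters to all machines.\<close>

lemma iterates_round_start:
  assumes "machines G \<ge> 1" "corrections A \<ge> 1" "r \<ge> 1"
  shows "iterates G A w (Suc (round_start A r)) p = avg_iterate G A w (Suc (round_start A r))"
proof (cases "r = 1")
  case True
  then show ?thesis using assms by (simp add: avg_iterate_1)
next
  case False
  then obtain r' where r': "r = Suc r'" "r' \<ge> 1" using assms(3) by (cases r) auto
  let ?t = "round_start A r"
  have "?t \<in> global_steps A r'"
    using r' assms(2) by (simp add: global_steps_eq round_start_Suc)
  then have "\<not> is_local A ?t" by (rule global_steps_not_local[OF r'(2)])
  moreover have "?t \<noteq> 0" using r' assms(2) by (simp add: round_start_Suc)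
  ultimately show ?thesis
    using assms(1) by (simp add: avg_iterate_def average_const Let_def)
qed

subsection \<open>Finiteness of the sample space\<close>

lemma valid_problem_part:
  assumes "valid_problem G" "p \<in> {1..machines G}"
  shows "part_nodes G p \<subseteq> nodes G" "part_edges G p \<subseteq> part_nodes G p \<times> part_nodes G p"
    "\<And>B nb. (B, nb) \<in> set_pmf (local_batch G p) \<Longrightarrow> B \<subseteq> part_nodes G p"
    "\<And>B nb l i. (B, nb) \<in> set_pmf (local_batch G p) \<Longrightarrow>
      nb l i \<subseteq> (if l \<in> {1..depth G} then part_nbrs G p i else {})"
    "\<And>B. B \<in> set_pmf (full_batch G p) \<Longrightarrow> B \<subseteq> part_nodes G p"
proof -
  have "(\<Union>p\<in>{1..machines G}. part_nodes G p) = nodes G"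
    using assms(1) unfolding valid_problem_def by (elim conjE)
  then show "part_nodes G p \<subseteq> nodes G" using assms(2) by blast
  have *: "part_nodes G p \<noteq> {} \<and>
       part_edges G p \<subseteq> edges G \<inter> part_nodes G p \<times> part_nodes G p \<and> sym (part_edges G p) \<and>
       (\<forall>(B, nb)\<in>set_pmf (local_batch G p). B \<noteq> {} \<and> B \<subseteq> part_nodes G p \<and>
          (\<forall>l i. nb l i \<subseteq> (if l \<in> {1..depth G} then part_nbrs G p i else {}))) \<and>
       (\<forall>B\<in>set_pmf (full_batch G p). B \<noteq> {} \<and> B \<subseteq> part_nodes G p)"
    using assms(1) unfolding valid_problem_def
    by (elim conjE) (erule bspec[OF _ assms(2)])
  then show "part_edges G p \<subseteq> part_nodes G p \<times> part_nodes G p" by (elim conjE) simp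
  from * have loc: "\<forall>(B, nb)\<in>set_pmf (local_batch G p). B \<noteq> {} \<and> B \<subseteq> part_nodes G p \<and>
      (\<forall>l i. nb l i \<subseteq> (if l \<in> {1..depth G} then part_nbrs G p i else {}))" by (elim conjE)
  show "B \<subseteq> part_nodes G p" if "(B, nb) \<in> set_pmf (local_batch G p)" for B nb
    using bspec[OF loc that] unfolding prod.case by (elim conjE)
  show "nb l i \<subseteq> (if l \<in> {1..depth G} then part_nbrs G p i else {})"
    if "(B, nb) \<in> set_pmf (local_batch G p)" for B nb l i
  proof -
    have "\<forall>l i. nb l i \<subseteq> (if l \<in> {1..depth G} then part_nbrs G p i else {})"
      using bspec[OF loc that] unfolding prod.case by (elim conjE)
    then show ?thesis by (rule allE) (erule allE)
  qed
  from * have "\<forall>B\<in>set_pmf (full_batch G p). B \<noteq> {} \<and> B \<subseteq> part_nodes G p" by (elim conjE)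
  then show "B \<subseteq> part_nodes G p" if "B \<in> set_pmf (full_batch G p)" for B using that by simp
qed

text \<open>A sampled neighbor map is empty off the finite set \<open>D\<close> and its values are
  sets of nodes, so only finitely many mini-batches can occur. Hence expectations over mini-batches
  are finite sums and integrability is automatic.\<close>

lemma finite_local_batch:
  assumes "valid_problem G" "p \<in> {1..machines G}"
  shows "finite (set_pmf (local_batch G p))"
proof -
  define D where "D = {1..depth G} \<times> nodes G"
  define F where "F = PiE_dflt D {} (\<lambda>_. Pow (nodes G))"
  have fin: "finite (nodes G)" using assms by (simp add: valid_problem_def)
  then have "finite F" unfolding F_def D_def by (intro finite_PiE_dflt) auto
  note part = valid_problem_part(1,2)[OF assms]
  have "set_pmf (local_batch G p) \<subseteq> Pow (nodes G) \<times> curry ` F"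
  proof
    fix x assume x: "x \<in> set_pmf (local_batch G p)"
    obtain B nb where x_eq: "x = (B, nb)" by fastforce
    note * = valid_problem_part(3,4)[OF assms x[unfolded x_eq]]
    have **: "nb l i = {}" if "(l, i) \<notin> D" for l i
      using *(2)[of l i] part that by (auto simp: D_def part_nbrs_def split: if_splits)
    have "nb l i \<subseteq> nodes G" for l i
      using *(2)[of l i] part by (auto simp: part_nbrs_def split: if_splits)
    with ** have "case_prod nb \<in> F" by (auto simp: F_def PiE_dflt_def)
    then have "nb \<in> curry ` F" by (metis curry_case_prod image_eqI)
    then show "x \<in> Pow (nodes G) \<times> curry ` F" using *(1) part x_eq by auto
  qed
  moreover have "finite (Pow (nodes G) \<times> curry ` F)" using fin \<open>finite F\<close> by simp
  ultimately show ?thesis by (rule finite_subset)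
qed

lemma finite_full_mini_batch:
  assumes "valid_problem G" "p \<in> {1..machines G}"
  shows "finite (set_pmf (full_mini_batch G p))"
proof -
  have "set_pmf (full_batch G p) \<subseteq> Pow (nodes G)"
    using valid_problem_part(1,5)[OF assms] by blast
  moreover have "finite (Pow (nodes G))" using assms by (simp add: valid_problem_def)
  ultimately have "finite (set_pmf (full_batch G p))" by (rule finite_subset)
  then show ?thesis unfolding full_mini_batch_def set_map_pmf by (rule finite_imageI)
qed

subsection \<open>A single step\<close>

text \<open>The analysis of steps and rounds needs of the rates only that they are equal, positive
  and satisfy \<open>L * local_rate A \<le> 1\<close>. Their value in terms of machines and steps is
  inserted in the final estimate.\<close>

locale llcg_run =
  fixes G :: gcn_problem and A :: llcg_params and L \<sigma>var \<sigma>bias \<sigma>global \<kappa>A \<kappa>X :: real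
  assumes problem: "valid_problem G" and params: "valid_params A" and L_pos: "L > 0"
    and smooth: "smooth_with L (global_loss G)"
    and smooth_local: "\<And>p. p \<in> {1..machines G} \<Longrightarrow> smooth_with L (local_loss G p)"
    and local_assm: "local_grad_assm G \<sigma>var \<sigma>bias"
    and full_assm: "full_grad_assm G \<sigma>global"
    and unbiased: "server_unbiased G"
    and discrepancy: "discrepancy_bound G \<kappa>A \<kappa>X"
    and rate_eq: "server_rate A = local_rate A"
    and rate_pos: "local_rate A > 0" and rate_le: "L * local_rate A \<le> 1"
begin

abbreviation "P \<equiv> machines G"
abbreviation "\<eta> \<equiv> local_rate A"
abbreviation "E f \<equiv> measure_pmf.expectation (batches G A) f"
abbreviation "gL \<equiv> grad (global_loss G)"
abbreviation "gloc p \<equiv> grad (local_loss G p)"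
abbreviation "lmean p \<theta> \<equiv> vmean (local_batch G p) (\<lambda>\<xi>. stoch_grad G \<xi> \<theta>)"

definition law :: "nat \<Rightarrow> nat \<Rightarrow> mini_batch pmf"
  where "law t p = (if is_local A t then local_batch G p else full_mini_batch G p)"

definition local_avg_grad :: "nat \<Rightarrow> (nat \<times> nat \<Rightarrow> mini_batch) \<Rightarrow> weights"
  where "local_avg_grad t w = average G (\<lambda>p. gloc p (iterates G A w t p))"

text \<open>The consensus error: the variance of the parameters of the machines around their
  average.\<close>

definition drift :: "nat \<Rightarrow> (nat \<times> nat \<Rightarrow> mini_batch) \<Rightarrow> real"
  where "drift t w = 1 / real P * (\<Sum>p=1..P. (norm (iterates G A w t p - avg_iterate G A w t))\<^sup>2)"

section \<open>Expectation over all mini-batches, and the mini-batch noise\<close>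

lemma P_ge_1: "P \<ge> 1" using problem by (simp add: valid_problem_def)

lemma finite_law: "p \<in> {1..P} \<Longrightarrow> finite (set_pmf (law t p))"
  by (simp add: law_def finite_local_batch finite_full_mini_batch problem)

lemma batches_eq:
  "batches G A = Pi_pmf ({1..total_steps A} \<times> {1..P}) ({}, \<lambda>l i. {}) (\<lambda>(t, p). law t p)"
  by (simp add: batches_def law_def)

lemma finite_batches: "finite (set_pmf (batches G A))"
  unfolding batches_eq using finite_law
  by (subst set_Pi_pmf) (auto intro!: finite_PiE_dflt)

lemma integrable_batches [simp]: "integrable (measure_pmf (batches G A)) (f :: _ \<Rightarrow> real)"
  by (rule integrable_finite_pmf[OF finite_batches])

lemma E_mono: "(\<And>w. f w \<le> g w) \<Longrightarrow> E f \<le> E g" for f g :: "_ \<Rightarrow> real"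
  by (intro integral_mono) auto

lemma E_nonneg: "(\<And>w. 0 \<le> f w) \<Longrightarrow> 0 \<le> E f" for f :: "_ \<Rightarrow> real"
  by (rule integral_nonneg_AE) simp

text \<open>\<open>F\<close> is the noise as a function of the mini-batch and of the parameters at
  which it is evaluated. Since \<open>Y\<close> and \<open>Z\<close> ignore the batch at
  \<open>(t, p)\<close>, resampling that batch reduces the claim to the zero mean of
  \<open>F\<close> at fixed parameters.\<close>

lemma expectation_noise_inner:
  assumes t: "t \<in> {1..total_steps A}" "p \<in> {1..P}"
    and Y: "\<And>w \<xi>. Y (w((t, p) := \<xi>)) = Y w" and Z: "\<And>w \<xi>. Z (w((t, p) := \<xi>)) = Z w"
    and F: "\<And>\<theta>. vmean (law t p) (\<lambda>\<xi>. F \<xi> \<theta>) = 0"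
  shows "E (\<lambda>w. F (w (t, p)) (Y w) \<bullet> Z w) = 0"
  unfolding batches_eq
  using t by (intro expectation_Pi_pmf_inner_eq_0[of _ "(t, p)"]) (auto simp: Y Z F finite_law)

lemma expectation_noise_norm:
  assumes t: "t \<in> {1..total_steps A}" "p \<in> {1..P}"
    and Y: "\<And>w \<xi>. Y (w((t, p) := \<xi>)) = Y w"
    and F: "\<And>\<theta>. measure_pmf.expectation (law t p) (\<lambda>\<xi>. (norm (F \<xi> \<theta>))\<^sup>2) \<le> s"
  shows "E (\<lambda>w. (norm (F (w (t, p)) (Y w)))\<^sup>2) \<le> s"
proof -
  have "E (\<lambda>w. (norm (F (w (t, p)) (Y w)))\<^sup>2) =
    E (\<lambda>w. measure_pmf.expectation (law t p) (\<lambda>\<xi>. (norm (F \<xi> (Y w)))\<^sup>2))"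
    unfolding batches_eq using t
    by (subst expectation_Pi_pmf_resample[of _ "(t, p)"]) (auto simp: Y finite_law)
  also have "\<dots> \<le> E (\<lambda>w. s)" by (intro E_mono F)
  finally show ?thesis by simp
qed

lemma expectation_average_noise_inner:
  assumes t: "t \<in> {1..total_steps A}"
    and Y: "\<And>p q w \<xi>. Y p (w((t, q) := \<xi>)) = Y p w" and Z: "\<And>q w \<xi>. Z (w((t, q) := \<xi>)) = Z w"
    and F: "\<And>p \<theta>. p \<in> {1..P} \<Longrightarrow> vmean (law t p) (\<lambda>\<xi>. F p \<xi> \<theta>) = 0"
  shows "E (\<lambda>w. average G (\<lambda>p. F p (w (t, p)) (Y p w)) \<bullet> Z w) = 0"
proof -
  have "E (\<lambda>w. F p (w (t, p)) (Y p w) \<bullet> Z w) = 0" if "p \<in> {1..P}" for p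
    using t that by (intro expectation_noise_inner Y Z F)
  then show ?thesis by (simp add: average_def inner_sum_left)
qed

text \<open>The noise of one machine does not change when the batch of another is resampled, so the
  summands are orthogonal even though the parameters \<open>Y p\<close> may be dependent.\<close>

lemma expectation_average_noise_norm:
  assumes t: "t \<in> {1..total_steps A}"
    and Y: "\<And>p q w \<xi>. Y p (w((t, q) := \<xi>)) = Y p w"
    and F: "\<And>p \<theta>. p \<in> {1..P} \<Longrightarrow> vmean (law t p) (\<lambda>\<xi>. F p \<xi> \<theta>) = 0"
      "\<And>p \<theta>. p \<in> {1..P} \<Longrightarrow> measure_pmf.expectation (law t p) (\<lambda>\<xi>. (norm (F p \<xi> \<theta>))\<^sup>2) \<le> s"
  shows "E (\<lambda>w. (norm (average G (\<lambda>p. F p (w (t, p)) (Y p w))))\<^sup>2) \<le> s / real P"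
proof -
  have "E (\<lambda>w. F p (w (t, p)) (Y p w) \<bullet> F q (w (t, q)) (Y q w)) = 0"
    if "p \<in> {1..P}" "q \<in> {1..P}" "p \<noteq> q" for p q
    using t that by (intro expectation_noise_inner Y F(1)) (auto simp: Y)
  moreover have "E (\<lambda>w. (norm (F p (w (t, p)) (Y p w)))\<^sup>2) \<le> s" if "p \<in> {1..P}" for p
    using t that by (intro expectation_noise_norm Y F(2))
  ultimately show ?thesis
    using expectation_norm_sq_mean_le[OF finite_batches, of "{1..P}" "\<lambda>p w. F p (w (t, p)) (Y p w)" s]
    by (simp add: average_def)
qed

lemma lmean_noise:
  assumes "is_local A t" "p \<in> {1..P}"
  shows "vmean (law t p) (\<lambda>\<xi>. stoch_grad G \<xi> \<theta> - lmean p \<theta>) = 0"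
    and "measure_pmf.expectation (law t p) (\<lambda>\<xi>. (norm (stoch_grad G \<xi> \<theta> - lmean p \<theta>))\<^sup>2) \<le> \<sigma>var\<^sup>2"
    and "(norm (lmean p \<theta> - gloc p \<theta>))\<^sup>2 \<le> \<sigma>bias\<^sup>2"
  using assms local_assm
  by (auto simp: law_def vmean_diff_const finite_local_batch problem local_grad_assm_def)

lemma server_noise:
  assumes "\<not> is_local A t" "p \<in> {1..P}"
  shows "vmean (law t p) (\<lambda>\<xi>. stoch_grad G \<xi> \<theta> - grad (full_loss G p) \<theta>) = 0"
    and "measure_pmf.expectation (law t p) (\<lambda>\<xi>. (norm (stoch_grad G \<xi> \<theta> - grad (full_loss G p) \<theta>))\<^sup>2)
      \<le> \<sigma>global\<^sup>2"
  using assms full_assm unbiased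
  by (auto simp: law_def vmean_diff_const finite_full_mini_batch problem full_grad_assm_def
      server_unbiased_def)

lemma average_full_grad: "average G (\<lambda>p. grad (full_loss G p) \<theta>) = gL \<theta>"
  using unbiased by (simp add: server_unbiased_def)

text \<open>The mean direction is the gradient itself, so the coefficient
  \<open>2 - \<eta> * L\<close> of the descent splits into \<open>1\<close> and
  \<open>1 - \<eta> * L\<close>. The second share will pay for discrepancy and bias of the local
  steps of the round; of the first only the weight \<open>\<eta> / 8\<close> is kept, which is what
  a local step provides.\<close>

lemma server_step:
  assumes t: "t \<in> {1..total_steps A}" "\<not> is_local A t"
  shows "\<eta> / 8 * exp_global_grad G A t \<le>
    E (\<lambda>w. global_loss G (avg_iterate G A w t)) - E (\<lambda>w. global_loss G (avg_iterate G A w (Suc t)))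
    - \<eta> / 2 * (1 - \<eta> * L) * exp_global_grad G A t + L / 2 * \<eta>\<^sup>2 * (\<sigma>global\<^sup>2 / real P)"
proof -
  define x where "x w = avg_iterate G A w t" for w
  define F where "F p \<xi> \<theta> = stoch_grad G \<xi> \<theta> - grad (full_loss G p) \<theta>" for p \<xi> \<theta>
  define N where "N w = average G (\<lambda>p. F p (w (t, p)) (x w))" for w
  have x: "x (w((t, q) := \<xi>)) = x w" for w q \<xi> by (simp add: x_def avg_iterate_upd)
  note F = server_noise[OF t(2), folded F_def]
  have "E (\<lambda>w. N w \<bullet> gL (x w)) = 0"
    unfolding N_def by (rule expectation_average_noise_inner[OF t(1), where F = F and Y = "\<lambda>p. x"]) (auto simp: x F)
  moreover have "E (\<lambda>w. (norm (N w))\<^sup>2) \<le> \<sigma>global\<^sup>2 / real P"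
    unfolding N_def by (rule expectation_average_noise_norm[OF t(1), where F = F and Y = "\<lambda>p. x"]) (auto simp: x F)
  moreover have "avg_iterate G A w (Suc t) = x w - \<eta> *\<^sub>R (gL (x w) + N w)" for w
    using avg_iterate_server[of G t A w] P_ge_1 t
    by (simp add: x_def N_def F_def average_diff average_full_grad rate_eq)
  ultimately have "E (\<lambda>w. global_loss G (avg_iterate G A w (Suc t)))
    \<le> E (\<lambda>w. global_loss G (x w))
      + \<eta> / 2 * E (\<lambda>w. - 2 * (gL (x w) \<bullet> gL (x w)) + \<eta> * L * (norm (gL (x w)))\<^sup>2)
      + L / 2 * \<eta>\<^sup>2 * (\<sigma>global\<^sup>2 / real P)"
    using expectation_smooth_descent[OF finite_batches smooth, of N x "\<lambda>w. gL (x w)"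
        "\<sigma>global\<^sup>2 / real P" \<eta>] L_pos by simp
  also have "E (\<lambda>w. - 2 * (gL (x w) \<bullet> gL (x w)) + \<eta> * L * (norm (gL (x w)))\<^sup>2) =
      (\<eta> * L - 2) * exp_global_grad G A t"
    by (simp add: exp_global_grad_def x_def power2_norm_eq_inner algebra_simps)
  finally have "E (\<lambda>w. global_loss G (avg_iterate G A w (Suc t)))
    \<le> E (\<lambda>w. global_loss G (x w)) + \<eta> / 2 * ((\<eta> * L - 2) * exp_global_grad G A t)
      + L / 2 * \<eta>\<^sup>2 * (\<sigma>global\<^sup>2 / real P)" .
  moreover have "0 \<le> \<eta> * exp_global_grad G A t"
    using rate_pos by (simp add: exp_global_grad_def E_nonneg)
  ultimately show ?thesis unfolding x_def by (simp add: algebra_simps add_divide_distrib diff_divide_distrib)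
qed

text \<open>The averaged direction is \<open>u w + b w + N w\<close>: local gradients, systematic
  bias and noise. Only the noise averages out; the bias is handled by
  \<open>biased_descent_bound\<close>, whose factor \<open>1 - \<eta> * L\<close> matches that of
  \<open>server_step\<close>.\<close>

lemma local_step:
  assumes t: "t \<in> {1..total_steps A}" "is_local A t"
  shows "\<eta> / 8 * exp_global_grad G A t \<le>
    E (\<lambda>w. global_loss G (avg_iterate G A w t)) - E (\<lambda>w. global_loss G (avg_iterate G A w (Suc t)))
    - \<eta> / 2 * (1 - \<eta> * L) * exp_local_grad G A t
    + \<eta> / 2 * ((1 + 3 / 2 * (\<eta> * L)\<^sup>2) * E (\<lambda>w. (norm (gL (avg_iterate G A w t) - local_avg_grad t w))\<^sup>2)
        + 2 * \<sigma>bias\<^sup>2)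
    + L / 2 * \<eta>\<^sup>2 * (\<sigma>var\<^sup>2 / real P)"
proof -
  define x where "x w = avg_iterate G A w t" for w
  define y where "y p w = iterates G A w t p" for p w
  define F where "F p \<xi> \<theta> = stoch_grad G \<xi> \<theta> - lmean p \<theta>" for p \<xi> \<theta>
  define N where "N w = average G (\<lambda>p. F p (w (t, p)) (y p w))" for w
  define b where "b w = average G (\<lambda>p. lmean p (y p w) - gloc p (y p w))" for w
  define u where "u = local_avg_grad t"
  have x: "x (w((t, q) := \<xi>)) = x w" for w q \<xi> by (simp add: x_def avg_iterate_upd)
  have y: "y p (w((t, q) := \<xi>)) = y p w" for p w q \<xi> by (simp add: y_def iterates_upd)
  have u: "u (w((t, q) := \<xi>)) = u w" for w q \<xi>
    by (simp add: u_def local_avg_grad_def iterates_upd)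
  have b: "b (w((t, q) := \<xi>)) = b w" for w q \<xi> by (simp add: b_def y)
  note F = lmean_noise(1,2)[OF t(2), folded F_def]
  have "E (\<lambda>w. N w \<bullet> gL (x w)) = 0" "E (\<lambda>w. N w \<bullet> (u w + b w)) = 0"
    unfolding N_def
    by (rule expectation_average_noise_inner[OF t(1), where F = F and Y = y]; auto simp: x y u b F)+
  moreover have "E (\<lambda>w. (norm (N w))\<^sup>2) \<le> \<sigma>var\<^sup>2 / real P"
    unfolding N_def by (rule expectation_average_noise_norm[OF t(1), where F = F and Y = y]) (auto simp: y F)
  moreover have "avg_iterate G A w (Suc t) = x w - \<eta> *\<^sub>R (u w + b w + N w)" for w
    using avg_iterate_local[of G t A w] P_ge_1 t
    by (simp add: x_def N_def F_def b_def u_def local_avg_grad_def y_def average_diff)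
  ultimately have "E (\<lambda>w. global_loss G (avg_iterate G A w (Suc t)))
    \<le> E (\<lambda>w. global_loss G (x w))
      + \<eta> / 2 * E (\<lambda>w. - 2 * (gL (x w) \<bullet> (u w + b w)) + \<eta> * L * (norm (u w + b w))\<^sup>2)
      + L / 2 * \<eta>\<^sup>2 * (\<sigma>var\<^sup>2 / real P)"
    using expectation_smooth_descent[OF finite_batches smooth, of N x "\<lambda>w. u w + b w"
        "\<sigma>var\<^sup>2 / real P" \<eta>] L_pos by simp
  also have "E (\<lambda>w. - 2 * (gL (x w) \<bullet> (u w + b w)) + \<eta> * L * (norm (u w + b w))\<^sup>2) \<le>
      E (\<lambda>w. (1 + 3 / 2 * (\<eta> * L)\<^sup>2) * (norm (gL (x w) - u w))\<^sup>2 - (norm (gL (x w)))\<^sup>2 / 4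
        - (1 - \<eta> * L) * (norm (u w))\<^sup>2 + 2 * \<sigma>bias\<^sup>2)"
  proof (intro E_mono biased_descent_bound)
    show "0 \<le> \<eta> * L" "\<eta> * L \<le> 1" using rate_pos L_pos rate_le by (auto simp: mult.commute)
    show "(norm (b w))\<^sup>2 \<le> \<sigma>bias\<^sup>2" for w
      unfolding b_def using P_ge_1 lmean_noise(3)[OF t(2)] by (rule norm_average_sq_le_const)
  qed
  also have "\<dots> = (1 + 3 / 2 * (\<eta> * L)\<^sup>2) * E (\<lambda>w. (norm (gL (x w) - u w))\<^sup>2)
      - exp_global_grad G A t / 4 - (1 - \<eta> * L) * exp_local_grad G A t + 2 * \<sigma>bias\<^sup>2"
    by (simp add: exp_global_grad_def exp_local_grad_def x_def u_def local_avg_grad_def)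
  finally show ?thesis
    using rate_pos unfolding x_def u_def by (simp add: algebra_simps add_divide_distrib diff_divide_distrib)
qed

text \<open>At a common point the full gradients average to the global gradient, so
  \<open>\<kappa>X\<close> does not appear. What remains is the gap \<open>e\<close> between local
  and full gradients at the average point, and the change \<open>d\<close> of the local gradients
  between that point and the local parameters, which smoothness bounds by the drift.\<close>

lemma E_grad_gap:
  assumes "c > 0"
  shows "E (\<lambda>w. (norm (gL (avg_iterate G A w t) - local_avg_grad t w))\<^sup>2)
    \<le> (1 + c) * \<kappa>A\<^sup>2 + (1 + 1 / c) * (L\<^sup>2 * E (drift t))"
proof -
  have "(norm (gL (avg_iterate G A w t) - local_avg_grad t w))\<^sup>2
    \<le> (1 + c) * \<kappa>A\<^sup>2 + (1 + 1 / c) * (L\<^sup>2 * drift t w)" for w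
  proof -
    define x where "x = avg_iterate G A w t"
    define y where "y p = iterates G A w t p" for p
    define e where "e = average G (\<lambda>p. gloc p x - grad (full_loss G p) x)"
    define d where "d = average G (\<lambda>p. gloc p (y p) - gloc p x)"
    have "(norm e)\<^sup>2 \<le> \<kappa>A\<^sup>2"
      unfolding e_def using P_ge_1 discrepancy
      by (intro norm_average_sq_le_const) (auto simp: discrepancy_bound_def)
    moreover have "(norm d)\<^sup>2 \<le> L\<^sup>2 * drift t w"
    proof -
      have "(norm d)\<^sup>2 \<le> 1 / real P * (\<Sum>p=1..P. (norm (gloc p (y p) - gloc p x))\<^sup>2)"
        unfolding d_def by (rule norm_average_sq_le)
      also have "\<dots> \<le> 1 / real P * (\<Sum>p=1..P. (L * norm (y p - x))\<^sup>2)"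
        by (intro mult_left_mono sum_mono power_mono smooth_with_le smooth_local) auto
      also have "\<dots> = L\<^sup>2 * drift t w"
        by (simp add: drift_def x_def y_def power_mult_distrib sum_distrib_left mult_ac)
      finally show ?thesis .
    qed
    moreover have "gL x - local_avg_grad t w = - (e + d)"
      by (simp add: e_def d_def y_def local_avg_grad_def average_diff average_full_grad)
    then have "(norm (gL x - local_avg_grad t w))\<^sup>2 \<le> (1 + c) * (norm e)\<^sup>2 + (1 + 1 / c) * (norm d)\<^sup>2"
      using norm_add_sq_le[OF assms, of e d] by (simp only: norm_minus_cancel)
    moreover have "0 \<le> 1 + c" "0 \<le> 1 + 1 / c" using assms by auto
    ultimately show ?thesis unfolding x_def[symmetric]
      by (meson add_mono mult_left_mono order_trans)
  qed
  then have "E (\<lambda>w. (norm (gL (avg_iterate G A w t) - local_avg_grad t w))\<^sup>2)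
    \<le> E (\<lambda>w. (1 + c) * \<kappa>A\<^sup>2 + (1 + 1 / c) * (L\<^sup>2 * drift t w))"
    by (rule E_mono)
  then show ?thesis by simp
qed

subsection \<open>Drift of the local parameters\<close>

text \<open>As \<open>Suc t\<close> is local, no averaging intervenes. The spread of the stochastic
  gradients around their mean is at most that around the global gradient at the average point, which
  splits into five parts: sampling noise, sampling bias, the two discrepancies, and
  displacement.\<close>

lemma E_drift_step:
  assumes t: "t \<in> {1..total_steps A}" "is_local A t" "is_local A (Suc t)" and c: "c > 0"
  shows "E (drift (Suc t)) \<le> (1 + c) * E (drift t)
    + (1 + 1 / c) * \<eta>\<^sup>2 * (5 * (\<sigma>var\<^sup>2 + \<sigma>bias\<^sup>2 + \<kappa>A\<^sup>2 + \<kappa>X\<^sup>2 + L\<^sup>2 * E (drift t)))"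
proof -
  define x where "x w = avg_iterate G A w t" for w
  define y where "y p w = iterates G A w t p" for p w
  define F where "F p \<xi> \<theta> = stoch_grad G \<xi> \<theta> - lmean p \<theta>" for p \<xi> \<theta>
  define g where "g p w = stoch_grad G (w (t, p)) (y p w)" for p w
  define M where "M = \<sigma>bias\<^sup>2 + \<kappa>A\<^sup>2 + \<kappa>X\<^sup>2"
  have 1: "drift (Suc t) w \<le> (1 + c) * drift t w
      + (1 + 1 / c) * \<eta>\<^sup>2 * (1 / real P * (\<Sum>p=1..P. (norm (g p w - gL (x w)))\<^sup>2))" for w
  proof -
    have "iterates G A w (Suc t) p - avg_iterate G A w (Suc t)
      = (y p w - x w) + (- \<eta> *\<^sub>R (g p w - average G (\<lambda>p. g p w)))" for p
      using t iterates_local[of t A G w p] avg_iterate_local[of G t A w] P_ge_1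
      by (simp add: x_def y_def g_def algebra_simps)
    then have "(norm (iterates G A w (Suc t) p - avg_iterate G A w (Suc t)))\<^sup>2
      \<le> (1 + c) * (norm (y p w - x w))\<^sup>2
        + (1 + 1 / c) * \<eta>\<^sup>2 * (norm (g p w - average G (\<lambda>p. g p w)))\<^sup>2" for p
      using norm_add_sq_le[OF c, of "y p w - x w" "- \<eta> *\<^sub>R (g p w - average G (\<lambda>p. g p w))"]
      by (simp add: power_mult_distrib mult.assoc)
    then have "drift (Suc t) w \<le> 1 / real P * (\<Sum>p=1..P. (1 + c) * (norm (y p w - x w))\<^sup>2
        + (1 + 1 / c) * \<eta>\<^sup>2 * (norm (g p w - average G (\<lambda>p. g p w)))\<^sup>2)"
      unfolding drift_def by (intro mult_left_mono sum_mono) auto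
    also have "\<dots> = (1 + c) * drift t w + (1 + 1 / c) * \<eta>\<^sup>2 *
        (1 / real P * (\<Sum>p=1..P. (norm (g p w - average G (\<lambda>p. g p w)))\<^sup>2))"
      unfolding drift_def x_def y_def sum.distrib sum_distrib_left[symmetric]
      by (simp only: distrib_left mult_ac)
    also have "\<dots> \<le> (1 + c) * drift t w
        + (1 + 1 / c) * \<eta>\<^sup>2 * (1 / real P * (\<Sum>p=1..P. (norm (g p w - gL (x w)))\<^sup>2))"
      using c P_ge_1 sum_norm_sq_diff_mean_le[of "{1..P}" "\<lambda>p. g p w" "gL (x w)"]
      by (intro add_left_mono mult_left_mono) (auto simp: average_def)
    finally show ?thesis .
  qed
  have 2: "E (\<lambda>w. (norm (g p w - gL (x w)))\<^sup>2)
    \<le> 5 * (\<sigma>var\<^sup>2 + M + L\<^sup>2 * E (\<lambda>w. (norm (y p w - x w))\<^sup>2))" if p: "p \<in> {1..P}" for p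
  proof -
    have "(norm (g p w - gL (x w)))\<^sup>2 \<le>
      5 * ((norm (F p (w (t, p)) (y p w)))\<^sup>2 + M + L\<^sup>2 * (norm (y p w - x w))\<^sup>2)" for w
    proof -
      have eq: "g p w - gL (x w) = F p (w (t, p)) (y p w)
        + (lmean p (y p w) - gloc p (y p w))
        + (gloc p (y p w) - grad (full_loss G p) (y p w))
        + (grad (full_loss G p) (y p w) - gL (y p w))
        + (gL (y p w) - gL (x w))"
        by (simp add: g_def F_def)
      have "(norm (gL (y p w) - gL (x w)))\<^sup>2 \<le> (L * norm (y p w - x w))\<^sup>2"
        by (intro power_mono smooth_with_le smooth) auto
      moreover have "(norm (gloc p (y p w) - grad (full_loss G p) (y p w)))\<^sup>2 \<le> \<kappa>A\<^sup>2"
          "(norm (grad (full_loss G p) (y p w) - gL (y p w)))\<^sup>2 \<le> \<kappa>X\<^sup>2"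
        using discrepancy p by (auto simp: discrepancy_bound_def)
      moreover note lmean_noise(3)[OF t(2) p, of "y p w"]
        norm_add5_sq_le[of "F p (w (t, p)) (y p w)" "lmean p (y p w) - gloc p (y p w)"
          "gloc p (y p w) - grad (full_loss G p) (y p w)"
          "grad (full_loss G p) (y p w) - gL (y p w)" "gL (y p w) - gL (x w)", folded eq]
      ultimately show ?thesis by (simp add: M_def power_mult_distrib)
    qed
    then have "E (\<lambda>w. (norm (g p w - gL (x w)))\<^sup>2) \<le>
      E (\<lambda>w. 5 * ((norm (F p (w (t, p)) (y p w)))\<^sup>2 + M + L\<^sup>2 * (norm (y p w - x w))\<^sup>2))"
      by (rule E_mono)
    also have "\<dots> = 5 * (E (\<lambda>w. (norm (F p (w (t, p)) (y p w)))\<^sup>2) + M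
        + L\<^sup>2 * E (\<lambda>w. (norm (y p w - x w))\<^sup>2))" by simp
    also have "E (\<lambda>w. (norm (F p (w (t, p)) (y p w)))\<^sup>2) \<le> \<sigma>var\<^sup>2"
      using t(1) p
      by (rule expectation_noise_norm)
        (simp add: y_def iterates_upd, unfold F_def, rule lmean_noise(2)[OF t(2) p])
    finally show ?thesis by simp
  qed
  have "E (drift (Suc t)) \<le> E (\<lambda>w. (1 + c) * drift t w
      + (1 + 1 / c) * \<eta>\<^sup>2 * (1 / real P * (\<Sum>p=1..P. (norm (g p w - gL (x w)))\<^sup>2)))"
    by (rule E_mono) (rule 1)
  also have "\<dots> = (1 + c) * E (drift t)
      + (1 + 1 / c) * \<eta>\<^sup>2 * (1 / real P * (\<Sum>p=1..P. E (\<lambda>w. (norm (g p w - gL (x w)))\<^sup>2)))"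
    by simp
  also have "\<dots> \<le> (1 + c) * E (drift t) + (1 + 1 / c) * \<eta>\<^sup>2 *
      (1 / real P * (\<Sum>p=1..P. 5 * (\<sigma>var\<^sup>2 + M + L\<^sup>2 * E (\<lambda>w. (norm (y p w - x w))\<^sup>2))))"
    using c by (intro add_left_mono mult_left_mono sum_mono 2) auto
  also have "1 / real P * (\<Sum>p=1..P. 5 * (\<sigma>var\<^sup>2 + M + L\<^sup>2 * E (\<lambda>w. (norm (y p w - x w))\<^sup>2))) =
      5 * (\<sigma>var\<^sup>2 + M + L\<^sup>2 * (1 / real P * (\<Sum>p=1..P. E (\<lambda>w. (norm (y p w - x w))\<^sup>2))))"
    using P_ge_1 by (simp add: sum.distrib field_simps flip: sum_distrib_left)
  also have "1 / real P * (\<Sum>p=1..P. E (\<lambda>w. (norm (y p w - x w))\<^sup>2)) = E (drift t)"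
    unfolding drift_def x_def y_def by simp
  finally show ?thesis by (simp add: M_def add.assoc)
qed

text \<open>A discrete Gronwall argument. Young's inequality with \<open>c = 1 / n\<close> and the
  feedback of the drift through smoothness each add at most \<open>1 / n\<close> to the growth
  factor, and \<open>1 + 2 / n \<le> exp (2 / n)\<close>. Over the \<open>n\<close> steps of the
  round the exponential stays below \<open>exp 2\<close>.\<close>

lemma E_drift_le_exp:
  fixes r k :: nat
  defines "n \<equiv> real (local_count A r)"
  assumes r: "r \<in> {1..rounds A}" and n: "(\<eta> * L * n)\<^sup>2 \<le> 1 / 20" and k: "k < local_count A r"
  shows "E (drift (Suc (round_start A r + k)))
    \<le> 10 * n * \<eta>\<^sup>2 * (\<sigma>var\<^sup>2 + \<sigma>bias\<^sup>2 + \<kappa>A\<^sup>2 + \<kappa>X\<^sup>2) * real k * exp (2 * real k / n)"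
  using k
proof (induction k)
  case 0
  \<comment> \<open>All machines agree at the first step of a round, so the recursion starts from
    zero.\<close>
  have "drift (Suc (round_start A r)) w = 0" for w
    using iterates_round_start[of G A r w] params r P_ge_1 by (simp add: drift_def valid_params_def)
  then show ?case by simp
next
  case (Suc k)
  define M where "M = \<sigma>var\<^sup>2 + \<sigma>bias\<^sup>2 + \<kappa>A\<^sup>2 + \<kappa>X\<^sup>2"
  define t where "t = Suc (round_start A r + k)"
  define V where "V = E (drift t)"
  have "n \<ge> 1" using Suc.prems by (simp add: n_def)
  have M: "M \<ge> 0" by (simp add: M_def)
  have V: "V \<ge> 0" unfolding V_def by (intro E_nonneg) (simp add: drift_def sum_nonneg)
  have t: "t \<in> local_steps A r" "Suc t \<in> local_steps A r"
    using Suc.prems by (auto simp: t_def local_steps_eq)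
  then have "t \<in> {1..total_steps A}" "is_local A t" "is_local A (Suc t)"
    using r steps_subset(1)[OF r] by (auto simp: is_local_def)
  from E_drift_step[OF this, of "1 / n"] \<open>n \<ge> 1\<close>
  have "E (drift (Suc t)) \<le> (1 + 1 / n) * V + (1 + n) * \<eta>\<^sup>2 * (5 * (M + L\<^sup>2 * V))"
    by (simp add: M_def V_def)
  also have "(1 + n) * \<eta>\<^sup>2 * (5 * (M + L\<^sup>2 * V)) \<le> (2 * n) * \<eta>\<^sup>2 * (5 * (M + L\<^sup>2 * V))"
    using \<open>n \<ge> 1\<close> M V by (intro mult_right_mono) auto
  also have "(2 * n) * \<eta>\<^sup>2 * (5 * (M + L\<^sup>2 * V)) = 10 * n * \<eta>\<^sup>2 * M + 10 * (\<eta> * L * n)\<^sup>2 / n * V"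
    using \<open>n \<ge> 1\<close> by (simp add: field_simps power2_eq_square)
  also have "10 * (\<eta> * L * n)\<^sup>2 / n * V \<le> 1 / n * V"
    using \<open>n \<ge> 1\<close> n V by (intro mult_right_mono divide_right_mono) auto
  finally have "E (drift (Suc t)) \<le> (1 + 2 / n) * V + 10 * n * \<eta>\<^sup>2 * M"
    by (simp add: algebra_simps)
  moreover have "(1 + 2 / n) * V \<le> exp (2 / n) * (10 * n * \<eta>\<^sup>2 * M * real k * exp (2 * real k / n))"
    using Suc V \<open>n \<ge> 1\<close> by (intro mult_mono exp_ge_add_one_self) (auto simp: V_def t_def M_def)
  moreover have "10 * n * \<eta>\<^sup>2 * M \<le> 10 * n * \<eta>\<^sup>2 * M * exp (2 * real (Suc k) / n)"
    using \<open>n \<ge> 1\<close> M mult_left_mono[of 1 "exp (2 * real (Suc k) / n)" "10 * n * \<eta>\<^sup>2 * M"] by simp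
  moreover have "exp (2 / n) * (10 * n * \<eta>\<^sup>2 * M * real k * exp (2 * real k / n))
      + 10 * n * \<eta>\<^sup>2 * M * exp (2 * real (Suc k) / n)
    = 10 * n * \<eta>\<^sup>2 * M * real (Suc k) * exp (2 * real (Suc k) / n)"
  proof -
    have "exp (2 * real (Suc k) / n) = exp (2 / n) * exp (2 * real k / n)"
      by (simp add: add_divide_distrib flip: exp_add)
    then show ?thesis by (simp add: algebra_simps)
  qed
  ultimately have "E (drift (Suc t)) \<le> 10 * n * \<eta>\<^sup>2 * M * real (Suc k) * exp (2 * real (Suc k) / n)"
    by linarith
  then show ?case by (simp add: t_def M_def)
qed

lemma E_drift_le:
  fixes r :: nat
  defines "n \<equiv> real (local_count A r)"
  assumes r: "r \<in> {1..rounds A}" and n: "(\<eta> * L * n)\<^sup>2 \<le> 1 / 20" and t: "t \<in> local_steps A r"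
  shows "E (drift t) \<le> 10 * exp 2 * (n * \<eta>)\<^sup>2 * (\<sigma>var\<^sup>2 + \<sigma>bias\<^sup>2 + \<kappa>A\<^sup>2 + \<kappa>X\<^sup>2)"
proof -
  define k where "k = t - Suc (round_start A r)"
  have k: "k < local_count A r" "t = Suc (round_start A r + k)"
    using t by (auto simp: k_def local_steps_eq)
  have "n \<ge> 1" using k by (simp add: n_def)
  have "E (drift t)
      \<le> 10 * n * \<eta>\<^sup>2 * (\<sigma>var\<^sup>2 + \<sigma>bias\<^sup>2 + \<kappa>A\<^sup>2 + \<kappa>X\<^sup>2) * real k * exp (2 * real k / n)"
    using E_drift_le_exp[OF r n[unfolded n_def] k(1)] by (simp add: n_def k(2))
  also have "\<dots> \<le> 10 * n * \<eta>\<^sup>2 * (\<sigma>var\<^sup>2 + \<sigma>bias\<^sup>2 + \<kappa>A\<^sup>2 + \<kappa>X\<^sup>2) * n * exp 2"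
    using k \<open>n \<ge> 1\<close> by (intro mult_mono) (auto simp: n_def divide_le_eq)
  finally show ?thesis by (simp add: power2_eq_square mult_ac)
qed

text \<open>The factor \<open>20 * exp 2\<close> is twice the constant of \<open>E_drift_le\<close>;
  the doubling comes from \<open>s * (s + 1) \<le> 2 * s\<close>. The discrepancy terms in front
  absorb the excess of the discrepancy coefficient over 1.\<close>

definition \<nu> :: real
  where "\<nu> = \<kappa>A\<^sup>2 + \<kappa>X\<^sup>2 + 20 * exp 2 * (\<sigma>var\<^sup>2 + \<sigma>bias\<^sup>2 + \<kappa>A\<^sup>2 + \<kappa>X\<^sup>2)"

text \<open>The drift is of order \<open>s\<^sup>2\<close>, so \<open>c = s\<close> leaves a
  first-order drift term while the discrepancy coefficient exceeds 1 only by \<open>s\<close>. A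
  leading coefficient of exactly 1 matters, because the correction steps compensate just this
  amount.\<close>

lemma E_grad_gap_le:
  fixes r :: nat
  defines "s \<equiv> \<eta> * L * real (local_count A r)"
  assumes r: "r \<in> {1..rounds A}" and s: "s\<^sup>2 \<le> 1 / 20" and t: "t \<in> local_steps A r"
  shows "E (\<lambda>w. (norm (gL (avg_iterate G A w t) - local_avg_grad t w))\<^sup>2) \<le> \<kappa>A\<^sup>2 + \<kappa>X\<^sup>2 + s * \<nu>"
proof -
  define M where "M = \<sigma>var\<^sup>2 + \<sigma>bias\<^sup>2 + \<kappa>A\<^sup>2 + \<kappa>X\<^sup>2"
  have "local_count A r \<ge> 1" using t by (auto simp: local_steps_eq)
  then have s_pos: "s > 0" using rate_pos L_pos by (simp add: s_def)
  have s_le: "s \<le> 1" using s s_pos by (intro power2_le_imp_le[of s 1]) auto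
  have "L\<^sup>2 * E (drift t) \<le> L\<^sup>2 * (10 * exp 2 * (real (local_count A r) * \<eta>)\<^sup>2 * M)"
    using E_drift_le[OF r s[unfolded s_def] t] unfolding M_def by (intro mult_left_mono) auto
  also have "\<dots> = s\<^sup>2 * (10 * exp 2 * M)"
    by (simp add: s_def power_mult_distrib mult_ac)
  finally have d: "L\<^sup>2 * E (drift t) \<le> s\<^sup>2 * (10 * exp 2 * M)" .
  have "E (\<lambda>w. (norm (gL (avg_iterate G A w t) - local_avg_grad t w))\<^sup>2)
      \<le> (1 + s) * \<kappa>A\<^sup>2 + (1 + 1 / s) * (L\<^sup>2 * E (drift t))"
    by (rule E_grad_gap[OF s_pos])
  also have "\<dots> \<le> (1 + s) * (\<kappa>A\<^sup>2 + \<kappa>X\<^sup>2) + (1 + 1 / s) * (s\<^sup>2 * (10 * exp 2 * M))"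
    using s_pos d by (intro add_mono mult_left_mono) auto
  also have "(1 + 1 / s) * (s\<^sup>2 * (10 * exp 2 * M)) = s * (s + 1) * (10 * exp 2 * M)"
    using s_pos by (simp add: field_simps power2_eq_square)
  also have "\<dots> \<le> s * 2 * (10 * exp 2 * M)"
    using s_pos s_le by (intro mult_right_mono mult_left_mono) (auto simp: M_def)
  finally show ?thesis by (simp add: \<nu>_def M_def algebra_simps)
qed

lemma local_step_le:
  fixes r :: nat
  defines "s \<equiv> \<eta> * L * real (local_count A r)"
  assumes r: "r \<in> {1..rounds A}" and s: "s\<^sup>2 \<le> 1 / 20" and t: "t \<in> local_steps A r"
  shows "\<eta> / 8 * exp_global_grad G A t \<le>
    E (\<lambda>w. global_loss G (avg_iterate G A w t)) - E (\<lambda>w. global_loss G (avg_iterate G A w (Suc t)))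
    - \<eta> / 2 * ((1 - \<eta> * L) * exp_local_grad G A t) + \<eta> / 2 * (\<kappa>A\<^sup>2 + \<kappa>X\<^sup>2 + 2 * \<sigma>bias\<^sup>2)
    + \<eta> / 2 * (3 * \<nu> * (s + (\<eta> * L)\<^sup>2)) + L / 2 * \<eta>\<^sup>2 * (\<sigma>var\<^sup>2 / real P)"
proof -
  define a where "a = \<eta> * L"
  define D where "D = E (\<lambda>w. (norm (gL (avg_iterate G A w t) - local_avg_grad t w))\<^sup>2)"
  have s_pos: "s \<ge> 0" using rate_pos L_pos by (simp add: s_def)
  have a: "0 \<le> a" "a \<le> 1" using rate_pos L_pos rate_le by (auto simp: a_def mult.commute)
  have \<nu>: "\<kappa>A\<^sup>2 + \<kappa>X\<^sup>2 \<le> \<nu>" by (simp add: \<nu>_def)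
  have \<nu>0: "0 \<le> \<nu>" by (simp add: \<nu>_def)
  have "(1 + 3 / 2 * a\<^sup>2) * D \<le> (1 + 3 / 2 * a\<^sup>2) * (\<kappa>A\<^sup>2 + \<kappa>X\<^sup>2 + s * \<nu>)"
    using E_grad_gap_le[OF r s[unfolded s_def] t] by (intro mult_left_mono) (auto simp: D_def s_def)
  also have "\<dots> = \<kappa>A\<^sup>2 + \<kappa>X\<^sup>2 + s * \<nu> + 3 / 2 * (a\<^sup>2 * (\<kappa>A\<^sup>2 + \<kappa>X\<^sup>2)) + 3 / 2 * (a\<^sup>2 * (s * \<nu>))"
    by (simp add: algebra_simps)
  also have "a\<^sup>2 * (\<kappa>A\<^sup>2 + \<kappa>X\<^sup>2) \<le> a\<^sup>2 * \<nu>" using \<nu> by (rule mult_left_mono) simp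
  also have "a\<^sup>2 * (s * \<nu>) \<le> 1 * (s * \<nu>)"
    using a s_pos \<nu>0 by (intro mult_right_mono) (auto simp: power_le_one)
  \<comment> \<open>The weights \<open>5 / 2\<close> of \<open>s * \<nu>\<close> and
    \<open>3 / 2\<close> of \<open>a\<^sup>2 * \<nu>\<close> are both rounded up to
    \<open>3\<close>.\<close>
  also have "\<kappa>A\<^sup>2 + \<kappa>X\<^sup>2 + s * \<nu> + 3 / 2 * (a\<^sup>2 * \<nu>) + 3 / 2 * (1 * (s * \<nu>))
      \<le> \<kappa>A\<^sup>2 + \<kappa>X\<^sup>2 + 3 * \<nu> * (s + a\<^sup>2)"
  proof -
    have "0 \<le> s * \<nu>" "0 \<le> a\<^sup>2 * \<nu>" using s_pos \<nu>0 by auto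
    then show ?thesis by (simp add: algebra_simps)
  qed
  finally have D: "(1 + 3 / 2 * a\<^sup>2) * D \<le> \<kappa>A\<^sup>2 + \<kappa>X\<^sup>2 + 3 * \<nu> * (s + a\<^sup>2)" by simp
  have "t \<in> {1..total_steps A}" "is_local A t"
    using r t steps_subset(1)[OF r] by (auto simp: is_local_def)
  note local_step[OF this, folded a_def D_def]
  also have "\<eta> / 2 * ((1 + 3 / 2 * a\<^sup>2) * D + 2 * \<sigma>bias\<^sup>2)
      \<le> \<eta> / 2 * (\<kappa>A\<^sup>2 + \<kappa>X\<^sup>2 + 3 * \<nu> * (s + a\<^sup>2) + 2 * \<sigma>bias\<^sup>2)"
    using rate_pos D by (intro mult_left_mono) auto
  finally show ?thesis by (simp add: a_def algebra_simps add_divide_distrib diff_divide_distrib)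
qed

subsection \<open>Summation over the rounds\<close>

text \<open>\<open>f t\<close> is what the step inequality leaves besides loss decrease and
  variance. As \<open>1 - \<eta> * L\<close> is nonnegative, each gradient term can be replaced by
  the minimum of its kind in the round. By \<open>corr\<close> the \<open>n\<close> local and
  \<open>corrections A\<close> server minima outweigh discrepancy and bias, and only the terms with
  \<open>\<nu>\<close> survive.\<close>

lemma round_sum_le:
  fixes r :: nat
  defines "n \<equiv> real (local_count A r)"
  defines "f \<equiv> \<lambda>t. \<eta> / 8 * exp_global_grad G A t
      - (E (\<lambda>w. global_loss G (avg_iterate G A w t)) - E (\<lambda>w. global_loss G (avg_iterate G A w (Suc t))))
      - L / 2 * \<eta>\<^sup>2 * ((\<sigma>var\<^sup>2 + \<sigma>global\<^sup>2) / real P)"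
  assumes r: "r \<in> {1..rounds A}" and n: "(\<eta> * L * n)\<^sup>2 \<le> 1 / 20"
    and corr: "n * (\<kappa>A\<^sup>2 + \<kappa>X\<^sup>2 + 2 * \<sigma>bias\<^sup>2)
      \<le> (1 - \<eta> * L) * (n * G_local G A r + real (corrections A) * G_global G A r)"
  shows "(\<Sum>t\<in>local_steps A r. f t) + (\<Sum>t\<in>global_steps A r. f t)
    \<le> 3 / 2 * \<eta> * \<nu> * (\<eta> * L * n\<^sup>2 + (\<eta> * L)\<^sup>2 * n)"
proof -
  define a where "a = \<eta> * L"
  define c where "c = \<eta> / 2 * (\<kappa>A\<^sup>2 + \<kappa>X\<^sup>2 + 2 * \<sigma>bias\<^sup>2 + 3 * \<nu> * (a * n + a\<^sup>2) - (1 - a) * G_local G A r)"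
  have a: "0 \<le> a" "a \<le> 1" using rate_pos L_pos rate_le by (auto simp: a_def mult.commute)
  have fin: "finite (local_steps A r)" "finite (global_steps A r)"
    and card: "card (local_steps A r) = local_count A r" "card (global_steps A r) = corrections A"
    using r by (simp_all add: local_steps_eq global_steps_eq)
  have split: "L / 2 * \<eta>\<^sup>2 * ((\<sigma>var\<^sup>2 + \<sigma>global\<^sup>2) / real P) =
      L / 2 * \<eta>\<^sup>2 * (\<sigma>var\<^sup>2 / real P) + L / 2 * \<eta>\<^sup>2 * (\<sigma>global\<^sup>2 / real P)"
    by (simp add: add_divide_distrib distrib_left)
  have nn: "0 \<le> L / 2 * \<eta>\<^sup>2 * (\<sigma>var\<^sup>2 / real P)" "0 \<le> L / 2 * \<eta>\<^sup>2 * (\<sigma>global\<^sup>2 / real P)"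
    using L_pos by auto
  have "f t \<le> c" if t: "t \<in> local_steps A r" for t
  proof -
    have "G_local G A r \<le> exp_local_grad G A t"
      unfolding G_local_def using fin t by (intro Min_le) auto
    then have "\<eta> / 2 * ((1 - a) * G_local G A r) \<le> \<eta> / 2 * ((1 - a) * exp_local_grad G A t)"
      using a rate_pos by (intro mult_left_mono) auto
    moreover have "c = \<eta> / 2 * (\<kappa>A\<^sup>2 + \<kappa>X\<^sup>2 + 2 * \<sigma>bias\<^sup>2) + \<eta> / 2 * (3 * \<nu> * (a * n + a\<^sup>2))
        - \<eta> / 2 * ((1 - a) * G_local G A r)"
      unfolding c_def by (simp only: distrib_left right_diff_distrib)
    ultimately show ?thesis
      using local_step_le[OF r n[unfolded n_def] t, folded n_def a_def] nn(2)
      unfolding f_def split by linarith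
  qed
  then have "(\<Sum>t\<in>local_steps A r. f t) \<le> n * c"
    using sum_bounded_above[of "local_steps A r" f c] card by (simp add: n_def)
  moreover have "f t \<le> - (\<eta> / 2 * (1 - a) * G_global G A r)" if t: "t \<in> global_steps A r" for t
  proof -
    have "G_global G A r \<le> exp_global_grad G A t"
      unfolding G_global_def using fin t by (intro Min_le) auto
    then have "\<eta> / 2 * (1 - a) * G_global G A r \<le> \<eta> / 2 * (1 - a) * exp_global_grad G A t"
      using a rate_pos by (intro mult_left_mono) auto
    moreover have "t \<in> {1..total_steps A}" "\<not> is_local A t"
      using r t steps_subset(2)[OF r] global_steps_not_local[of r t A] by auto
    ultimately show ?thesis
      using server_step[of t, folded a_def] nn(1) unfolding f_def split by linarith
  qed
  then have "(\<Sum>t\<in>global_steps A r. f t) \<le> real (corrections A) * (- (\<eta> / 2 * (1 - a) * G_global G A r))"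
    using sum_bounded_above[of "global_steps A r" f "- (\<eta> / 2 * (1 - a) * G_global G A r)"] card by simp
  ultimately have "(\<Sum>t\<in>local_steps A r. f t) + (\<Sum>t\<in>global_steps A r. f t)
    \<le> n * c + real (corrections A) * (- (\<eta> / 2 * (1 - a) * G_global G A r))" by simp
  also have "\<dots> = \<eta> / 2 * (n * (\<kappa>A\<^sup>2 + \<kappa>X\<^sup>2 + 2 * \<sigma>bias\<^sup>2)
        - (1 - a) * (n * G_local G A r + real (corrections A) * G_global G A r))
      + 3 / 2 * \<eta> * \<nu> * (a * n\<^sup>2 + a\<^sup>2 * n)"
    by (simp add: c_def power2_eq_square field_simps)
  also have "\<dots> \<le> 3 / 2 * \<eta> * \<nu> * (a * n\<^sup>2 + a\<^sup>2 * n)"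
    using rate_pos corr by (simp add: a_def mult_nonneg_nonpos)
  finally show ?thesis by (simp add: a_def)
qed

text \<open>The loss differences telescope from the initial parameters to those after the last step,
  whose expected loss is at least the infimum.\<close>

lemma sum_exp_global_grad_le:
  assumes n: "\<And>r. r \<in> {1..rounds A} \<Longrightarrow> (\<eta> * L * real (local_count A r))\<^sup>2 \<le> 1 / 20"
    and corr: "\<And>r. r \<in> {1..rounds A} \<Longrightarrow>
      real (local_count A r) * (\<kappa>A\<^sup>2 + \<kappa>X\<^sup>2 + 2 * \<sigma>bias\<^sup>2)
        \<le> (1 - \<eta> * L) * (real (local_count A r) * G_local G A r + real (corrections A) * G_global G A r)"
    and bdd: "bdd_below (range (global_loss G))"
  shows "\<eta> / 8 * (\<Sum>t=1..total_steps A. exp_global_grad G A t)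
    \<le> global_loss G (init A) - (INF \<theta>. global_loss G \<theta>)
      + 3 / 2 * \<eta> * \<nu> * (\<eta> * L * (\<Sum>r=1..rounds A. (real (local_count A r))\<^sup>2)
          + (\<eta> * L)\<^sup>2 * real (total_steps A))
      + real (total_steps A) * (L / 2 * \<eta>\<^sup>2 * ((\<sigma>var\<^sup>2 + \<sigma>global\<^sup>2) / real P))"
proof -
  define h where "h t = E (\<lambda>w. global_loss G (avg_iterate G A w t))" for t
  define v where "v = L / 2 * \<eta>\<^sup>2 * ((\<sigma>var\<^sup>2 + \<sigma>global\<^sup>2) / real P)"
  define f where "f t = \<eta> / 8 * exp_global_grad G A t - (h t - h (Suc t)) - v" for t
  define T where "T = total_steps A"
  have tel: "(\<Sum>t=1..m. h t - h (Suc t)) = h 1 - h (Suc m)" for m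
    by (induction m) auto
  have "h 1 = global_loss G (init A)"
    using P_ge_1 by (simp add: h_def avg_iterate_1)
  moreover have "(INF \<theta>. global_loss G \<theta>) \<le> h (Suc T)"
  proof -
    have "E (\<lambda>w. INF \<theta>. global_loss G \<theta>) \<le> h (Suc T)"
      unfolding h_def by (intro E_mono cINF_lower bdd) simp
    then show ?thesis by simp
  qed
  moreover have "(\<Sum>t=1..T. f t) \<le> 3 / 2 * \<eta> * \<nu> *
      (\<eta> * L * (\<Sum>r=1..rounds A. (real (local_count A r))\<^sup>2) + (\<eta> * L)\<^sup>2 * real T)"
  proof -
    have "(\<Sum>t=1..T. f t) = (\<Sum>r=1..rounds A. (\<Sum>t\<in>local_steps A r. f t) + (\<Sum>t\<in>global_steps A r. f t))"
      unfolding T_def by (rule sum_steps)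
    also have "\<dots> \<le> (\<Sum>r=1..rounds A. 3 / 2 * \<eta> * \<nu> *
        (\<eta> * L * (real (local_count A r))\<^sup>2 + (\<eta> * L)\<^sup>2 * real (local_count A r)))"
      unfolding f_def h_def v_def by (intro sum_mono round_sum_le n corr)
    also have "\<dots> = 3 / 2 * \<eta> * \<nu> * (\<eta> * L * (\<Sum>r=1..rounds A. (real (local_count A r))\<^sup>2)
        + (\<eta> * L)\<^sup>2 * real (\<Sum>r=1..rounds A. local_count A r))"
      unfolding sum_distrib_left[symmetric] sum.distrib of_nat_sum ..
    also have "\<dots> \<le> 3 / 2 * \<eta> * \<nu> *
      (\<eta> * L * (\<Sum>r=1..rounds A. (real (local_count A r))\<^sup>2) + (\<eta> * L)\<^sup>2 * real T)"
    proof (intro mult_left_mono add_left_mono)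
      show "real (\<Sum>r=1..rounds A. local_count A r) \<le> real T"
        unfolding of_nat_le_iff by (simp add: T_def total_steps_def)
      show "0 \<le> 3 / 2 * \<eta> * \<nu>" using rate_pos by (simp add: \<nu>_def)
    qed simp
    finally show ?thesis .
  qed
  moreover have "(\<Sum>t=1..T. f t) = \<eta> / 8 * (\<Sum>t=1..T. exp_global_grad G A t)
      - (\<Sum>t=1..T. h t - h (Suc t)) - real T * v"
    by (simp add: f_def sum_subtractf sum_distrib_left)
  ultimately show ?thesis unfolding tel T_def v_def by linarith
qed

end

section \<open>Inserting the rates and the growth condition\<close>

theorem theorem2:
  fixes L \<Delta> \<sigma>var \<sigma>bias \<sigma>global \<kappa> :: real
  assumes "L > 0"
  shows "\<exists>C::real. \<forall>(G :: gcn_problem) (A :: llcg_params) (P :: nat) (T :: nat) \<kappa>A \<kappa>X.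
    P = machines G \<longrightarrow> T = total_steps A \<longrightarrow>
    valid_problem G \<longrightarrow> valid_params A \<longrightarrow>
    smooth_with L (global_loss G) \<longrightarrow>
    (\<forall>p\<in>{1..P}. smooth_with L (local_loss G p)) \<longrightarrow>
    bdd_below (range (global_loss G)) \<longrightarrow>
    global_loss G (init A) - (INF \<theta>. global_loss G \<theta>) = \<Delta> \<longrightarrow>
    local_grad_assm G \<sigma>var \<sigma>bias \<longrightarrow>
    full_grad_assm G \<sigma>global \<longrightarrow>
    server_unbiased G \<longrightarrow>
    discrepancy_bound G \<kappa>A \<kappa>X \<longrightarrow> \<kappa>\<^sup>2 = \<kappa>A\<^sup>2 + \<kappa>X\<^sup>2 \<longrightarrow>
    local_rate A = sqrt (real P) / sqrt (real T) \<longrightarrow>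
    server_rate A = sqrt (real P) / sqrt (real T) \<longrightarrow>
    (\<Sum>r=1..rounds A. (real (loc_K A))\<^sup>2 * loc_\<rho> A ^ (2 * r))
      \<le> real (rounds A) * real T powr (1/2) / (32 * L\<^sup>2 * real P powr (3/2)) \<longrightarrow>
    (\<forall>r\<in>{1..rounds A}. G_global G A r \<noteq> 0) \<longrightarrow>
    int (corrections A) =
      \<lceil>Max ((\<lambda>r. ((\<kappa>\<^sup>2 + 2 * \<sigma>bias\<^sup>2) / (1 - L * sqrt (real P / real T)) - G_local G A r)
                 * (real (loc_K A) * loc_\<rho> A ^ r / G_global G A r)) ` {1..rounds A})\<rceil> \<longrightarrow>
    real T \<ge> L\<^sup>2 * real P \<longrightarrow>
    1 / real T * (\<Sum>t=1..T. exp_global_grad G A t) \<le> C / sqrt (real P * real T)"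
proof (rule exI, intro allI impI)
  \<comment> \<open>\<open>K\<close> becomes the constant \<open>\<nu>\<close> of the locale. It is
    written in terms of \<open>\<kappa>\<close> so that it is fixed before the graph,
    \<open>\<kappa>A\<close> and \<open>\<kappa>X\<close>.\<close>
  define K where "K = \<kappa>\<^sup>2 + 20 * exp 2 * (\<sigma>var\<^sup>2 + \<sigma>bias\<^sup>2 + \<kappa>\<^sup>2)"
  fix G :: gcn_problem and A :: llcg_params and P T :: nat and \<kappa>A \<kappa>X :: real
  assume P: "P = machines G" and T: "T = total_steps A"
    and valid: "valid_problem G" "valid_params A"
    and smooth: "smooth_with L (global_loss G)" "\<forall>p\<in>{1..P}. smooth_with L (local_loss G p)"
    and bdd: "bdd_below (range (global_loss G))"
    and \<Delta>: "global_loss G (init A) - (INF \<theta>. global_loss G \<theta>) = \<Delta>"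
    and assms1: "local_grad_assm G \<sigma>var \<sigma>bias" "full_grad_assm G \<sigma>global" "server_unbiased G"
      "discrepancy_bound G \<kappa>A \<kappa>X"
    and \<kappa>: "\<kappa>\<^sup>2 = \<kappa>A\<^sup>2 + \<kappa>X\<^sup>2"
    and rate: "local_rate A = sqrt (real P) / sqrt (real T)" "server_rate A = sqrt (real P) / sqrt (real T)"
    and sq: "(\<Sum>r=1..rounds A. (real (loc_K A))\<^sup>2 * loc_\<rho> A ^ (2 * r))
      \<le> real (rounds A) * real T powr (1/2) / (32 * L\<^sup>2 * real P powr (3/2))"
    and G0: "\<forall>r\<in>{1..rounds A}. G_global G A r \<noteq> 0"
    and S: "int (corrections A) =
      \<lceil>Max ((\<lambda>r. ((\<kappa>\<^sup>2 + 2 * \<sigma>bias\<^sup>2) / (1 - L * sqrt (real P / real T)) - G_local G A r)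
                 * (real (loc_K A) * loc_\<rho> A ^ r / G_global G A r)) ` {1..rounds A})\<rceil>"
    and TP: "real T \<ge> L\<^sup>2 * real P"
  \<comment> \<open>With the square roots \<open>p\<close> and \<open>s\<close> all fractional
    powers become integer powers, and the target rate is \<open>1 / (p * s)\<close>.\<close>
  define p where "p = sqrt (real P)"
  define s where "s = sqrt (real T)"
  define \<eta> where "\<eta> = p / s"
  define n where "n r = real (local_count A r)" for r
  define R where "R = real (rounds A)"
  define Q where "Q = (\<Sum>r=1..rounds A. (n r)\<^sup>2)"
  have R1: "rounds A \<ge> 1" and S1: "corrections A \<ge> 1" using valid(2) by (auto simp: valid_params_def)
  have "P \<ge> 1" using valid(1) P by (simp add: valid_problem_def)
  then have p: "p \<ge> 1" "p > 0" "p\<^sup>2 = real P" by (auto simp: p_def)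
  have n1: "n r \<ge> 1" if "r \<in> {1..rounds A}" for r
    using local_count_ge[OF valid(2), of r] that by (simp add: n_def)
  have "(rounds A)\<^sup>2 \<le> 2 * T" unfolding T by (rule rounds_sq_le[OF valid(2)])
  then have "real ((rounds A)\<^sup>2) \<le> real (2 * T)" by (rule of_nat_mono)
  then have RT: "R\<^sup>2 \<le> 2 * real T" by (simp add: R_def)
  moreover have "R \<ge> 1" using R1 by (simp add: R_def)
  ultimately have "real T > 0" by (smt (verit) one_le_power)
  then have s: "s > 0" "s\<^sup>2 = real T" by (auto simp: s_def)
  have "\<eta> > 0" using p s by (simp add: \<eta>_def)
  have "(L * p)\<^sup>2 \<le> s\<^sup>2" using TP p s by (simp add: power_mult_distrib)
  then have "L * p \<le> s" using s by (intro power2_le_imp_le[of "L * p" s]) auto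
  then have L\<eta>: "L * \<eta> \<le> 1" using s by (simp add: \<eta>_def)
  \<comment> \<open>A rational bound above the square root of 2, chosen such that
    \<open>16 / 10 / 32 = 1 / 20\<close>.\<close>
  have "R \<le> 16 / 10 * s"
    using RT s by (intro power2_le_imp_le[of R "16 / 10 * s"]) (auto simp: power_mult_distrib power_divide)
  have Q: "Q \<le> R * s / (32 * L\<^sup>2 * p ^ 3)"
  proof -
    have "Q = (\<Sum>r=1..rounds A. (real (loc_K A))\<^sup>2 * loc_\<rho> A ^ (2 * r))"
      unfolding Q_def n_def using valid(2)
      by (intro sum.cong refl) (simp add: real_local_count power_mult_distrib flip: power_mult mult.commute[of 2])
    moreover have "real T powr (1 / 2) = s" by (simp add: s_def powr_half_sqrt)
    moreover have "real P powr (3 / 2) = p ^ 3"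
    proof -
      have "real P powr (3 / 2) = real P powr (1 + 1 / 2)" by simp
      also have "\<dots> = real P * sqrt (real P)" unfolding powr_add by (simp add: powr_half_sqrt)
      also have "\<dots> = p ^ 3" by (simp add: p_def power3_eq_cube)
      finally show ?thesis .
    qed
    ultimately show ?thesis using sq by (simp add: R_def)
  qed
  \<comment> \<open>Every round has at least one local step. Together with \<open>Q\<close>,
    cancelling \<open>R\<close> turns the growth condition into the lower bound \<open>Ls\<close> on
    the number of steps.\<close>
  have RQ: "R \<le> Q"
  proof -
    have "(\<Sum>r=1..rounds A. 1) \<le> Q" unfolding Q_def using n1 by (intro sum_mono) (simp add: one_le_power)
    then show ?thesis by (simp add: R_def)
  qed
  have "R * 1 \<le> R * (s / (32 * L\<^sup>2 * p ^ 3))" using RQ Q by simp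
  then have "1 \<le> s / (32 * L\<^sup>2 * p ^ 3)" using \<open>R \<ge> 1\<close> by (subst (asm) mult_le_cancel_left_pos) auto
  then have Ls: "32 * L\<^sup>2 * p ^ 3 \<le> s" using assms p by (simp add: le_divide_eq)
  have \<eta>Q: "L * \<eta> * Q \<le> s / (20 * L * p\<^sup>2)"
  proof -
    have "L * \<eta> * Q \<le> L * \<eta> * (16 / 10 * s * s / (32 * L\<^sup>2 * p ^ 3))"
      using Q \<open>R \<le> 16 / 10 * s\<close> assms \<open>\<eta> > 0\<close> s p
      by (intro mult_left_mono order_trans[OF Q] divide_right_mono mult_right_mono) auto
    also have "\<dots> = s / (20 * L * p\<^sup>2)"
      using assms p(2) s(1) by (simp add: \<eta>_def field_simps power2_eq_square power3_eq_cube)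
    finally show ?thesis .
  qed
  have n_le: "(\<eta> * L * n r)\<^sup>2 \<le> 1 / 20" if r: "r \<in> {1..rounds A}" for r
  proof -
    \<comment> \<open>One square is at most the whole sum, so the growth condition also controls
      each single round.\<close>
    have "(n r)\<^sup>2 \<le> Q" unfolding Q_def using r by (intro member_le_sum) auto
    then have "L * \<eta> * (L * \<eta> * (n r)\<^sup>2) \<le> L * \<eta> * (L * \<eta> * Q)"
      using assms \<open>\<eta> > 0\<close> by (intro mult_left_mono) auto
    also have "\<dots> \<le> L * \<eta> * (s / (20 * L * p\<^sup>2))"
      using assms \<open>\<eta> > 0\<close> by (intro mult_left_mono \<eta>Q) auto
    also have "\<dots> = 1 / (20 * p)"
      using assms p(2) s(1) by (simp add: \<eta>_def field_simps power2_eq_square)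
    also have "\<dots> \<le> 1 / 20" using p by (simp add: field_simps)
    finally show ?thesis by (simp add: power2_eq_square mult_ac)
  qed
  interpret llcg_run G A L \<sigma>var \<sigma>bias \<sigma>global \<kappa>A \<kappa>X
    using valid smooth assms assms1 rate P \<open>\<eta> > 0\<close> L\<eta>
    by unfold_locales (auto simp: \<eta>_def p_def s_def)
  \<comment> \<open>Both are minima of expected squares, hence nonnegative. The assumed nonvanishing
    makes the global one positive, so that inequalities can be multiplied by it.\<close>
  have G_global: "G_global G A r > 0" and G_local: "G_local G A r \<ge> 0" if r: "r \<in> {1..rounds A}" for r
  proof -
    have "G_global G A r \<in> exp_global_grad G A ` global_steps A r"
      unfolding G_global_def using r S1 by (intro Min_in) (auto simp: global_steps_eq)
    then have "G_global G A r \<ge> 0" by (auto simp: exp_global_grad_def intro!: E_nonneg)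
    then show "G_global G A r > 0" using G0 r by force
    have "G_local G A r \<in> exp_local_grad G A ` local_steps A r"
      unfolding G_local_def using r n1[OF r] by (intro Min_in) (auto simp: local_steps_eq n_def)
    then show "G_local G A r \<ge> 0" by (auto simp: exp_local_grad_def intro!: E_nonneg)
  qed
  have "sqrt (real P / real T) = \<eta>" by (simp add: \<eta>_def p_def s_def real_sqrt_divide)
  define b where "b r = ((\<kappa>\<^sup>2 + 2 * \<sigma>bias\<^sup>2) / (1 - L * \<eta>) - G_local G A r) * (n r / G_global G A r)" for r
  have S_eq: "int (corrections A) = \<lceil>Max (b ` {1..rounds A})\<rceil>"
    unfolding S \<open>sqrt (real P / real T) = \<eta>\<close> b_def n_def
    using valid(2) by (simp add: real_local_count cong: image_cong_simp)
  have S_ge: "b r \<le> real (corrections A)" if r: "r \<in> {1..rounds A}" for r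
  proof -
    have "b r \<le> Max (b ` {1..rounds A})" using r by (intro Max_ge) auto
    also have "\<dots> \<le> real_of_int \<lceil>Max (b ` {1..rounds A})\<rceil>" by (rule le_of_int_ceiling)
    also have "\<dots> = real (corrections A)" unfolding S_eq[symmetric] by simp
    finally show ?thesis .
  qed
  \<comment> \<open>In the boundary case the division by \<open>0\<close> in \<open>b\<close> gives \<open>0\<close>, so there would be no correction step.\<close>
  have "L * \<eta> \<noteq> 1"
  proof
    assume "L * \<eta> = 1"
    then have "b r \<le> 0" if "r \<in> {1..rounds A}" for r
      using G_global[OF that] G_local[OF that] n1[OF that] by (simp add: b_def mult_nonneg_nonneg)
    then have "Max (b ` {1..rounds A}) \<le> 0" using R1 by (subst Max_le_iff) auto
    then show False using S1 S_eq by linarith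
  qed
  with L\<eta> have L\<eta>1: "L * \<eta> < 1" by simp
  \<comment> \<open>This undoes the divisions in the formula for the correction steps, first by
    \<open>G_global G A r\<close> and then by \<open>1 - L * \<eta>\<close>, and yields the
    compensation hypothesis of \<open>sum_exp_global_grad_le\<close>.\<close>
  have corr: "n r * (\<kappa>\<^sup>2 + 2 * \<sigma>bias\<^sup>2)
      \<le> (1 - L * \<eta>) * (n r * G_local G A r + real (corrections A) * G_global G A r)"
    if r: "r \<in> {1..rounds A}" for r
  proof -
    have "b r * G_global G A r \<le> real (corrections A) * G_global G A r"
      using G_global[OF r] by (intro mult_right_mono S_ge r) simp
    moreover have "b r * G_global G A r = n r * ((\<kappa>\<^sup>2 + 2 * \<sigma>bias\<^sup>2) / (1 - L * \<eta>) - G_local G A r)"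
      using G_global[OF r] by (simp add: b_def)
    ultimately have "n r * ((\<kappa>\<^sup>2 + 2 * \<sigma>bias\<^sup>2) / (1 - L * \<eta>))
      \<le> n r * G_local G A r + real (corrections A) * G_global G A r"
      by (simp add: right_diff_distrib)
    then have "(1 - L * \<eta>) * (n r * ((\<kappa>\<^sup>2 + 2 * \<sigma>bias\<^sup>2) / (1 - L * \<eta>)))
      \<le> (1 - L * \<eta>) * (n r * G_local G A r + real (corrections A) * G_global G A r)"
      using L\<eta>1 by (intro mult_left_mono) auto
    then show ?thesis using L\<eta>1 by simp
  qed
  define X where "X = (\<Sum>t=1..T. exp_global_grad G A t)"
  have rate': "local_rate A = \<eta>" by (simp add: rate \<eta>_def p_def s_def)
  have K: "K = \<nu>" by (simp add: K_def \<nu>_def \<kappa> add.assoc)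
  have main: "\<eta> / 8 * X \<le> \<Delta> + 3 / 2 * \<eta> * K * (L * \<eta> * Q + (\<eta> * L)\<^sup>2 * s\<^sup>2)
      + s\<^sup>2 * (L / 2 * \<eta>\<^sup>2 * ((\<sigma>var\<^sup>2 + \<sigma>global\<^sup>2) / p\<^sup>2))"
    using sum_exp_global_grad_le[OF _ _ bdd] n_le corr
    by (simp add: K rate' \<Delta> \<kappa> X_def T s p P Q_def n_def mult.commute[of L])
  have K0: "K \<ge> 0" by (simp add: K_def)
  have "L * \<eta> * Q / s\<^sup>2 \<le> s / (20 * L * p\<^sup>2) / s\<^sup>2"
    using \<eta>Q by (rule divide_right_mono) simp
  also have "\<dots> = 1 / (20 * L) / (p * s) / p"
    using p(2) s(1) by (simp add: field_simps power2_eq_square)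
  also have "\<dots> \<le> 1 / (20 * L) / (p * s) / 1"
    using p s assms by (intro divide_left_mono) auto
  finally have 1: "L * \<eta> * Q / s\<^sup>2 \<le> 1 / (20 * L) / (p * s)" by simp
  \<comment> \<open>This second-order term reaches the target rate because \<open>Ls\<close> trades
    \<open>32 * L\<^sup>2 * p ^ 3\<close> for \<open>s\<close>.\<close>
  have "(\<eta> * L)\<^sup>2 = 32 * L\<^sup>2 * p ^ 3 / (32 * p * s\<^sup>2)"
    using p(2) by (simp add: \<eta>_def power_mult_distrib power_divide power2_eq_square power3_eq_cube)
  also have "\<dots> \<le> s / (32 * p * s\<^sup>2)"
    using Ls p s by (intro divide_right_mono) auto
  also have "\<dots> = 1 / 32 / (p * s)"
    using s(1) by (simp add: power2_eq_square)
  finally have 2: "(\<eta> * L)\<^sup>2 \<le> 1 / 32 / (p * s)" .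
  \<comment> \<open>Since \<open>\<eta> * s\<^sup>2 = p * s\<close>, this factor brings the initial
    gap to the target rate. The variance term reaches it through the division by
    \<open>p\<^sup>2\<close>, that is, by averaging over the machines.\<close>
  have "X / s\<^sup>2 = 8 / (\<eta> * s\<^sup>2) * (\<eta> / 8 * X)" using \<open>\<eta> > 0\<close> by simp
  also have "\<dots> \<le> 8 / (\<eta> * s\<^sup>2) * (\<Delta> + 3 / 2 * \<eta> * K * (L * \<eta> * Q + (\<eta> * L)\<^sup>2 * s\<^sup>2)
      + s\<^sup>2 * (L / 2 * \<eta>\<^sup>2 * ((\<sigma>var\<^sup>2 + \<sigma>global\<^sup>2) / p\<^sup>2)))"
    using main \<open>\<eta> > 0\<close> by (intro mult_left_mono) auto
  also have "\<dots> = 8 * \<Delta> / (\<eta> * s\<^sup>2) + 12 * K * (L * \<eta> * Q / s\<^sup>2 + (\<eta> * L)\<^sup>2)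
      + 4 * L * (\<sigma>var\<^sup>2 + \<sigma>global\<^sup>2) * (\<eta> / p\<^sup>2)"
    using \<open>\<eta> > 0\<close> s(1) p(2) by (simp add: divide_simps) (simp add: algebra_simps power2_eq_square)
  also have "\<dots> \<le> 8 * \<Delta> / (\<eta> * s\<^sup>2) + 12 * K * (1 / (20 * L) / (p * s) + 1 / 32 / (p * s))
      + 4 * L * (\<sigma>var\<^sup>2 + \<sigma>global\<^sup>2) * (\<eta> / p\<^sup>2)"
    using K0 assms by (intro add_mono mult_left_mono 1 2) auto
  also have "\<dots> = (8 * \<Delta> + 12 * K * (1 / (20 * L) + 1 / 32) + 4 * L * (\<sigma>var\<^sup>2 + \<sigma>global\<^sup>2)) / (p * s)"
  proof -
    have "\<eta> * s\<^sup>2 = p * s" "\<eta> / p\<^sup>2 = 1 / (p * s)"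
      using p(2) s(1) by (simp_all add: \<eta>_def power2_eq_square)
    then show ?thesis by (simp add: add_divide_distrib distrib_left)
  qed
  finally show "1 / real T * (\<Sum>t=1..T. exp_global_grad G A t)
    \<le> (8 * \<Delta> + 12 * K * (1 / (20 * L) + 1 / 32) + 4 * L * (\<sigma>var\<^sup>2 + \<sigma>global\<^sup>2)) / sqrt (real P * real T)"
    by (simp add: X_def s p_def s_def real_sqrt_mult)
qed

end
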